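(* Suppose $\mathbb{L}$ is irreducible. Then its unique extended steady state $R_+$ is faithful, and for every $X\in\mathfrak{A}$, $$ \lim_{N\to\infty}\frac1N\sum_{n=0}^{N-1}\mathcal{L}^*_{\omega_1}\cdots\mathcal{L}^*_{\omega_n}X(\omega_{n+1})=\langle R_+,X\rangle\,\mathbf{1} $$ for $\mathbb{P}$-almost every $\boldsymbol\omega\in\boldsymbol\Omega$ and in $L^1(\boldsymbol\Omega,\mathbb{P};\mathcal{B}(\mathcal{H}))$, where $\mathbf 1$ is the identity operator on $\mathcal{H}$. In particular, for any family of initial states $(\rho_\omega)_{\omega\in\Omega}$ and any $X\in\mathfrak{A}$, $$ \lim_{N\to\infty}\frac1N\sum_{n=0}^{N-1}\langle\rho_n(\boldsymbol\omega),X(\omega_{n+1})\rangle=\langle R_+,X\rangle $$ holds $\mathbb{P}$-almost surely and in $L^1(\boldsymbol\Omega,\mathbb{P})$. Moreover, if $\mathbb{L}$ is primitive, then $$ \lim_{n\to\infty}\mathbb{E}_+[\langle\rho_n(\boldsymbol\omega),X(\omega_{n+1})\rangle]=\langle R_+,X\rangle . $$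
   Context: Setting. $\Omega$ is a finite nonempty set, $\mathcal{H}$ a finite-dimensional nonzero complex Hilbert space, $\pi$ a probability vector on $\Omega$, $P=(P_{\omega\nu})$ a right stochastic $\Omega\times\Omega$ matrix, $(\mathcal{L}_\omega)_{\omega\in\Omega}$ a family of completely positive trace-preserving maps on $\mathcal{B}(\mathcal{H})$, and $(\rho_\omega)_{\omega\in\Omega}$ a family of states (non-negative operators of trace one) on $\mathcal{H}$. $\mathcal{L}_\omega^*$ is the adjoint of $\mathcal{L}_\omega$ for the pairing $\langle\alpha,A\rangle=\mathrm{tr}(\alpha^*A)$. $\mathfrak{A}$ is the algebra of functions $X:\Omega\to\mathcal{B}(\mathcal{H})$, $\mathfrak{A}_*$ the same space of functions with norm $\sum_\omega\|R(\omega)\|_1$, paired by $\langle R,X\rangle=\sum_\omega\mathrm{tr}(R(\omega)^*X(\omega))$. An element is $\ge0$ (resp. $>0$, "faithful") if all its values are positive semidefinite (resp. positive definite). Extended states: $\mathfrak{A}_{*+1}=\{R\in\mathfrak{A}_*: R\ge0,\ \sum_\omega\mathrm{tr}R(\omega)=1\}$. An extended steady state is $R_+\in\mathfrak{A}_{*+1}$ with $\mathbb{L}R_+=R_+$, where $(\mathbb{L}R)(\omega)=\sum_{\nu}P_{\nu\omega}\mathcal{L}_\nu R(\nu)$. A linear map $\Phi$ is positivity improving if $\Phi(Y)>0$ whenever $Y\ge0$, $Y\ne0$; a positive map $\Phi$ is primitive if $\Phi^n$ is positivity improving for some $n\in\mathbb N$, and irreducible if $e^{t\Phi}$ is positivity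 improving for some $t>0$. $\boldsymbol\Omega=\Omega^{\mathbb{N}}$ with product $\sigma$-algebra, $\boldsymbol\omega=(\omega_0,\omega_1,\dots)$. $\mathbb{P}$ is the Markov measure with $\mathbb{P}(\omega_0=\nu_0,\dots,\omega_n=\nu_n)=\pi_{\nu_0}P_{\nu_0\nu_1}\cdots P_{\nu_{n-1}\nu_n}$. When $\mathbb{L}$ is irreducible, $P$ has a unique invariant probability vector $\pi_+$, given by $\pi_{+\omega}=\mathrm{tr}R_+(\omega)$; $\mathbb{E}_+$ is the expectation for the Markov measure with initial distribution $\pi_+$ and transition matrix $P$. $\rho_n(\boldsymbol\omega)=\mathcal{L}_{\omega_n}\cdots\mathcal{L}_{\omega_1}\rho_{\omega_0}$. *)

theory Defs
  imports "HOL-Probability.Probability"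
begin

text \<open>
  The Hilbert space is \<open>complex ^ 'n\<close> (every nonzero finite-dimensional one, up to a choice of
  orthonormal basis), its operators are the matrices \<open>complex ^ 'n ^ 'n\<close>, and the finite nonempty
  set of the environment states is a type \<open>'w\<close> of class \<^class>\<open>finite\<close>.  A function from \<open>'w\<close>
  to operators is encoded as a vector \<open>X :: complex ^ 'n ^ 'n ^ 'w\<close> with values \<open>X $ w\<close>, so that
  the normed space structure is available.
\<close>

subsection \<open>Operators on a finite-dimensional complex Hilbert space\<close>

definition cinner :: "complex ^ 'n \<Rightarrow> complex ^ 'n \<Rightarrow> complex" where
  "cinner u v = (\<Sum>i\<in>UNIV. cnj (u $ i) * v $ i)"

definition cadjoint :: "complex ^ 'n ^ 'n \<Rightarrow> complex ^ 'n ^ 'n" where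
  "cadjoint A = map_matrix cnj (transpose A)"

definition hs_pairing :: "complex ^ 'n ^ 'n \<Rightarrow> complex ^ 'n ^ 'n \<Rightarrow> complex" where
  "hs_pairing \<alpha> A = trace (cadjoint \<alpha> ** A)"

text \<open>Over the complex numbers a real-valued quadratic form already forces self-adjointness.\<close>

definition psd :: "complex ^ 'n ^ 'n \<Rightarrow> bool" where
  "psd A \<longleftrightarrow> (\<forall>v. cinner v (A *v v) \<in> \<real>\<^sub>\<ge>\<^sub>0)"

definition pos_def :: "complex ^ 'n ^ 'n \<Rightarrow> bool" where
  "pos_def A \<longleftrightarrow> (\<forall>v. v \<noteq> 0 \<longrightarrow> cinner v (A *v v) \<in> \<real>\<^sub>\<ge>\<^sub>0 - {0})"

definition is_state :: "complex ^ 'n ^ 'n \<Rightarrow> bool" where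
  "is_state \<rho> \<longleftrightarrow> psd \<rho> \<and> trace \<rho> = 1"

text \<open>The norm of the type \<open>complex ^ 'n ^ 'n\<close> is the Hilbert-Schmidt norm, not the operator norm.\<close>

definition op_norm :: "complex ^ 'n ^ 'n \<Rightarrow> real" where
  "op_norm A = onorm (\<lambda>v. A *v v)"

subsection \<open>Completely positive trace-preserving maps\<close>

text \<open>\<^const>\<open>linear\<close> is only linearity over the reals.\<close>

definition clinear_map :: "(complex ^ 'n ^ 'n \<Rightarrow> complex ^ 'n ^ 'n) \<Rightarrow> bool" where
  "clinear_map L \<longleftrightarrow> (\<forall>A B. L (A + B) = L A + L B) \<and>
     (\<forall>c A. L (map_matrix ((*) c) A) = map_matrix ((*) c) (L A))"

text \<open>
  Positivity of the operator with \<open>m \<times> m\<close> blocks \<open>A i j\<close> (indices below \<open>m\<close>) on the direct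
  sum of \<open>m\<close> copies of the Hilbert space, i.e. on its tensor product with the space of
  dimension \<open>m\<close>.  Under this identification \<open>L \<otimes> id\<close> applies \<open>L\<close> to each block.
\<close>

definition block_psd :: "nat \<Rightarrow> (nat \<Rightarrow> nat \<Rightarrow> complex ^ 'n ^ 'n) \<Rightarrow> bool" where
  "block_psd m A \<longleftrightarrow> (\<forall>v. (\<Sum>i<m. \<Sum>j<m. cinner (v i) (A i j *v v j)) \<in> \<real>\<^sub>\<ge>\<^sub>0)"

definition completely_positive :: "(complex ^ 'n ^ 'n \<Rightarrow> complex ^ 'n ^ 'n) \<Rightarrow> bool" where
  "completely_positive L \<longleftrightarrow> clinear_map L \<and>
     (\<forall>m A. block_psd m A \<longrightarrow> block_psd m (\<lambda>i j. L (A i j)))"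

definition trace_preserving :: "(complex ^ 'n ^ 'n \<Rightarrow> complex ^ 'n ^ 'n) \<Rightarrow> bool" where
  "trace_preserving L \<longleftrightarrow> (\<forall>A. trace (L A) = trace A)"

definition cptp :: "(complex ^ 'n ^ 'n \<Rightarrow> complex ^ 'n ^ 'n) \<Rightarrow> bool" where
  "cptp L \<longleftrightarrow> completely_positive L \<and> trace_preserving L"

definition dual_map ::
  "(complex ^ 'n ^ 'n \<Rightarrow> complex ^ 'n ^ 'n) \<Rightarrow> complex ^ 'n ^ 'n \<Rightarrow> complex ^ 'n ^ 'n" where
  "dual_map L = (THE K. \<forall>\<alpha> A. hs_pairing \<alpha> (K A) = hs_pairing (L \<alpha>) A)"

lemma hs_pairing_eq: "hs_pairing \<alpha> A = (\<Sum>i\<in>UNIV. \<Sum>j\<in>UNIV. cnj (\<alpha> $ j $ i) * A $ j $ i)"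
  by (simp add: hs_pairing_def trace_def cadjoint_def matrix_matrix_mult_def transpose_def)

lemma hs_pairing_unit:
  "hs_pairing (\<chi> k l. if k = i \<and> l = j then 1 else 0) A = A $ i $ j"
proof -
  have "hs_pairing (\<chi> k l. if k = i \<and> l = j then 1 else 0) A
      = (\<Sum>l\<in>UNIV. \<Sum>k\<in>UNIV. if l = j then (if k = i then A $ k $ l else 0) else 0)"
    unfolding hs_pairing_eq by (intro sum.cong refl) auto
  also have "\<dots> = (\<Sum>l\<in>UNIV. if l = j then A $ i $ l else 0)"
    by (intro sum.cong refl) auto
  also have "\<dots> = A $ i $ j"
    by simp
  finally show ?thesis .
qed

lemma dual_map:
  fixes L :: "complex ^ 'n ^ 'n \<Rightarrow> complex ^ 'n ^ 'n"
  assumes "clinear_map L"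
  shows "hs_pairing \<alpha> (dual_map L A) = hs_pairing (L \<alpha>) A"
proof -
  define E :: "'n \<Rightarrow> 'n \<Rightarrow> complex ^ 'n ^ 'n" where
    "E i j = (\<chi> k l. if k = i \<and> l = j then 1 else 0)" for i j
  define K where "K A = (\<chi> i j. hs_pairing (L (E i j)) A)" for A
  have add: "L (A + B) = L A + L B" and scale: "L (map_matrix ((*) c) A) = map_matrix ((*) c) (L A)"
    for A B c
    using assms by (auto simp: clinear_map_def)
  have "L 0 + L 0 = L 0"
    using add[of 0 0] by simp
  then have zero: "L 0 = 0"
    by simp
  have L_sum: "L (sum f S) = (\<Sum>s\<in>S. L (f s))" if "finite S" for f :: "'n \<Rightarrow> _" and S
    using that by (induction S) (auto simp: zero add)
  have expand: "\<alpha> = (\<Sum>i\<in>UNIV. \<Sum>j\<in>UNIV. map_matrix ((*) (\<alpha> $ j $ i)) (E j i))" for \<alpha>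
  proof -
    have "(\<Sum>i\<in>UNIV. \<Sum>j\<in>UNIV. map_matrix ((*) (\<alpha> $ j $ i)) (E j i)) $ k $ l = \<alpha> $ k $ l" for k l
    proof -
      have "(\<Sum>i\<in>UNIV. \<Sum>j\<in>UNIV. map_matrix ((*) (\<alpha> $ j $ i)) (E j i)) $ k $ l
        = (\<Sum>i\<in>UNIV. \<Sum>j\<in>UNIV. if j = k then (if i = l then \<alpha> $ j $ i else 0) else 0)"
        unfolding sum_component by (intro sum.cong refl) (auto simp: E_def)
      also have "\<dots> = \<alpha> $ k $ l"
        by simp
      finally show ?thesis .
    qed
    then show ?thesis
      by (simp add: vec_eq_iff)
  qed
  have pair_add: "hs_pairing (A + B) C = hs_pairing A C + hs_pairing B C" for A B C :: "complex ^ 'n ^ 'n"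
    by (simp add: hs_pairing_eq ring_distribs sum.distrib)
  have pair_zero: "hs_pairing 0 C = 0" for C :: "complex ^ 'n ^ 'n"
    by (simp add: hs_pairing_eq)
  have pair_sum: "hs_pairing (sum f S) C = (\<Sum>s\<in>S. hs_pairing (f s) C)" if "finite S"
    for f :: "'n \<Rightarrow> _" and S and C :: "complex ^ 'n ^ 'n"
    using that by (induction S) (auto simp: pair_zero pair_add)
  have pair_scale: "hs_pairing (map_matrix ((*) c) A) C = cnj c * hs_pairing A C"
    for c and A C :: "complex ^ 'n ^ 'n"
    by (simp add: hs_pairing_eq sum_distrib_left mult.assoc)
  have K: "hs_pairing \<alpha> (K A) = hs_pairing (L \<alpha>) A" for \<alpha> A
  proof -
    have "hs_pairing (L \<alpha>) A
        = hs_pairing (\<Sum>i\<in>UNIV. \<Sum>j\<in>UNIV. map_matrix ((*) (\<alpha> $ j $ i)) (L (E j i))) A"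
      by (subst expand[of \<alpha>]) (simp add: L_sum scale)
    also have "\<dots> = (\<Sum>i\<in>UNIV. \<Sum>j\<in>UNIV. cnj (\<alpha> $ j $ i) * hs_pairing (L (E j i)) A)"
      by (simp add: pair_sum pair_scale)
    also have "\<dots> = hs_pairing \<alpha> (K A)"
      by (simp add: hs_pairing_eq[of \<alpha>] K_def)
    finally show ?thesis ..
  qed
  have "K' = K" if "\<forall>\<alpha> A. hs_pairing \<alpha> (K' A) = hs_pairing (L \<alpha>) A" for K'
  proof
    fix A
    have "hs_pairing (E i j) (K' A) = hs_pairing (E i j) (K A)" for i j
      using that K by simp
    then have "K' A $ i $ j = K A $ i $ j" for i j
      unfolding E_def hs_pairing_unit .
    then show "K' A = K A"
      by (subst vec_eq_iff, intro allI, subst vec_eq_iff) blast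
  qed
  then have "dual_map L = K"
    unfolding dual_map_def using K by (intro the_equality) blast+
  then show ?thesis
    using K by simp
qed

subsection \<open>The extended algebra and its maps\<close>

definition ext_pairing :: "complex ^ 'n ^ 'n ^ 'w \<Rightarrow> complex ^ 'n ^ 'n ^ 'w \<Rightarrow> complex" where
  "ext_pairing R X = (\<Sum>w\<in>UNIV. hs_pairing (R $ w) (X $ w))"

definition ext_nonneg :: "complex ^ 'n ^ 'n ^ 'w \<Rightarrow> bool" where
  "ext_nonneg X \<longleftrightarrow> (\<forall>w. psd (X $ w))"

definition faithful :: "complex ^ 'n ^ 'n ^ 'w \<Rightarrow> bool" where
  "faithful X \<longleftrightarrow> (\<forall>w. pos_def (X $ w))"

definition extended_state :: "complex ^ 'n ^ 'n ^ 'w \<Rightarrow> bool" where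
  "extended_state R \<longleftrightarrow> ext_nonneg R \<and> (\<Sum>w\<in>UNIV. trace (R $ w)) = 1"

definition ext_map ::
  "real ^ 'w ^ 'w \<Rightarrow> ('w \<Rightarrow> complex ^ 'n ^ 'n \<Rightarrow> complex ^ 'n ^ 'n) \<Rightarrow>
   complex ^ 'n ^ 'n ^ 'w \<Rightarrow> complex ^ 'n ^ 'n ^ 'w" where
  "ext_map P L R = (\<chi> w. \<Sum>v\<in>UNIV. (P $ v $ w) *\<^sub>R L v (R $ v))"

definition extended_steady_state ::
  "real ^ 'w ^ 'w \<Rightarrow> ('w \<Rightarrow> complex ^ 'n ^ 'n \<Rightarrow> complex ^ 'n ^ 'n) \<Rightarrow>
   complex ^ 'n ^ 'n ^ 'w \<Rightarrow> bool" where
  "extended_steady_state P L R \<longleftrightarrow> extended_state R \<and> ext_map P L R = R"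

definition positive_map ::
  "(complex ^ 'n ^ 'n ^ 'w \<Rightarrow> complex ^ 'n ^ 'n ^ 'w) \<Rightarrow> bool" where
  "positive_map \<Phi> \<longleftrightarrow> (\<forall>Y. ext_nonneg Y \<longrightarrow> ext_nonneg (\<Phi> Y))"

definition positivity_improving ::
  "(complex ^ 'n ^ 'n ^ 'w \<Rightarrow> complex ^ 'n ^ 'n ^ 'w) \<Rightarrow> bool" where
  "positivity_improving \<Phi> \<longleftrightarrow> (\<forall>Y. ext_nonneg Y \<and> Y \<noteq> 0 \<longrightarrow> faithful (\<Phi> Y))"

text \<open>The semigroup \<open>exp (t \<Phi>)\<close> given by the exponential series, for linear \<open>\<Phi>\<close>.\<close>

definition exp_map :: "real \<Rightarrow> ('a \<Rightarrow> 'a) \<Rightarrow> 'a \<Rightarrow> 'a::real_normed_vector" where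
  "exp_map t \<Phi> Y = (\<Sum>k. (t ^ k / fact k) *\<^sub>R (\<Phi> ^^ k) Y)"

definition primitive_map ::
  "(complex ^ 'n ^ 'n ^ 'w \<Rightarrow> complex ^ 'n ^ 'n ^ 'w) \<Rightarrow> bool" where
  "primitive_map \<Phi> \<longleftrightarrow> positive_map \<Phi> \<and> (\<exists>n. positivity_improving (\<Phi> ^^ n))"

definition irreducible_map ::
  "(complex ^ 'n ^ 'n ^ 'w \<Rightarrow> complex ^ 'n ^ 'n ^ 'w) \<Rightarrow> bool" where
  "irreducible_map \<Phi> \<longleftrightarrow> positive_map \<Phi> \<and> (\<exists>t>0. positivity_improving (exp_map t \<Phi>))"

subsection \<open>The Markov measure\<close>

definition prob_vector :: "real ^ 'w \<Rightarrow> bool" where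
  "prob_vector p \<longleftrightarrow> (\<forall>w. 0 \<le> p $ w) \<and> (\<Sum>w\<in>UNIV. p $ w) = 1"

definition right_stochastic :: "real ^ 'w ^ 'w \<Rightarrow> bool" where
  "right_stochastic P \<longleftrightarrow> (\<forall>w. prob_vector (P $ w))"

definition invariant_prob_vector :: "real ^ 'w ^ 'w \<Rightarrow> real ^ 'w \<Rightarrow> bool" where
  "invariant_prob_vector P p \<longleftrightarrow> prob_vector p \<and> p v* P = p"

definition is_markov_measure ::
  "real ^ 'w \<Rightarrow> real ^ 'w ^ 'w \<Rightarrow> (nat \<Rightarrow> 'w) measure \<Rightarrow> bool" where
  "is_markov_measure p P M \<longleftrightarrow>
     sets M = sets (PiM UNIV (\<lambda>_. count_space UNIV)) \<and>
     (\<forall>n v. emeasure M {w. \<forall>i\<le>n. w i = v i} = ennreal (p $ v 0 * (\<Prod>i<n. P $ v i $ v (Suc i))))"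

definition markov_measure :: "real ^ 'w \<Rightarrow> real ^ 'w ^ 'w \<Rightarrow> (nat \<Rightarrow> 'w) measure" where
  "markov_measure p P = (THE M. is_markov_measure p P M)"

lemma cylinder_sets:
  fixes v :: "nat \<Rightarrow> 'w::finite"
  shows "{w. \<forall>i\<le>n. w i = v i} \<in> sets (PiM UNIV (\<lambda>_. count_space UNIV))"
proof -
  have "{w. \<forall>i\<le>n. w i = v i} = prod_emb UNIV (\<lambda>_. count_space UNIV) {..n} (PiE {..n} (\<lambda>i. {v i}))"
    by (auto simp: prod_emb_def PiE_iff)
  then show ?thesis
    by (simp add: sets_PiM_I_finite)
qed

lemma markov_measure_unique:
  fixes p :: "real ^ 'w" and P :: "real ^ 'w ^ 'w"
  assumes M: "is_markov_measure p P M" and N: "is_markov_measure p P N"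
  shows "M = N"
proof -
  let ?Q = "PiM UNIV (\<lambda>_::nat. count_space (UNIV :: 'w set))"
  have sM: "sets M = sets ?Q" and sN: "sets N = sets ?Q"
    using M N by (auto simp: is_markov_measure_def)
  have sp: "space M = UNIV"
    using sets_eq_imp_space_eq[OF sM] by (simp add: space_PiM)
  have cyl: "{w. \<forall>i\<le>n. w i = v i} \<in> sets ?Q" for n and v :: "nat \<Rightarrow> 'w"
    by (rule cylinder_sets)
  have eq: "emeasure M {w. \<forall>i\<le>n. w i = v i} = emeasure N {w. \<forall>i\<le>n. w i = v i}" for n v
    using M N by (simp add: is_markov_measure_def)
  \<comment> \<open>A set depending on finitely many coordinates is a finite disjoint union of cylinders.\<close>
  have box: "emeasure M A = emeasure N A \<and> emeasure M A < \<infinity>"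
    if A: "\<And>w w'. (\<And>i. i \<le> n \<Longrightarrow> w i = w' i) \<Longrightarrow> w \<in> A \<Longrightarrow> w' \<in> A" for A n
  proof -
    define I where "I = {v \<in> PiE {..n} (\<lambda>_. UNIV). \<exists>w\<in>A. \<forall>i\<le>n. w i = v i}"
    define B where "B v = {w. \<forall>i\<le>n. w i = v i}" for v :: "nat \<Rightarrow> 'w"
    have cylB: "B v \<in> sets ?Q" for v
      unfolding B_def by (rule cyl)
    have fin: "finite I"
      unfolding I_def by (rule finite_subset[OF _ finite_PiE[of "{..n}" "\<lambda>_. UNIV :: 'w set"]]) auto
    have disj: "disjoint_family_on B I"
      unfolding disjoint_family_on_def B_def I_def
      by (auto simp: PiE_eq_iff set_eq_iff) (metis PiE_arb atMost_iff ext)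
    have un: "A = (\<Union>v\<in>I. B v)"
    proof (intro equalityI subsetI)
      fix w assume "w \<in> A"
      then have "restrict w {..n} \<in> I" "w \<in> B (restrict w {..n})"
        by (auto simp: I_def B_def)
      then show "w \<in> (\<Union>v\<in>I. B v)" by blast
    next
      fix w assume "w \<in> (\<Union>v\<in>I. B v)"
      then obtain v w' where "w \<in> B v" "w' \<in> A" "\<forall>i\<le>n. w' i = v i"
        by (auto simp: I_def)
      then show "w \<in> A"
        by (intro A[of w' w]) (auto simp: B_def)
    qed
    have "emeasure M A = (\<Sum>v\<in>I. emeasure M (B v))"
      unfolding un using fin disj cylB by (intro sum_emeasure[symmetric]) (auto simp: sM)
    moreover have "emeasure N A = (\<Sum>v\<in>I. emeasure N (B v))"
      unfolding un using fin disj cylB by (intro sum_emeasure[symmetric]) (auto simp: sN)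
    moreover have "(\<Sum>v\<in>I. emeasure M (B v)) < \<infinity>"
      using M fin by (auto simp: B_def is_markov_measure_def)
    ultimately show ?thesis
      by (simp add: B_def eq)
  qed
  show ?thesis
  proof (rule measure_eqI_PiM_infinite)
    show "sets M = sets ?Q" "sets N = sets ?Q" by fact+
    show "finite_measure M"
      using box[of 0 UNIV] by (intro finite_measureI) (auto simp: sp)
  next
    fix J :: "nat set" and F :: "nat \<Rightarrow> 'w set"
    assume J: "finite J"
    then obtain n where n: "\<And>i. i \<in> J \<Longrightarrow> i \<le> n"
      by (meson finite_nat_set_iff_bounded_le)
    show "emeasure M (prod_emb UNIV (\<lambda>_. count_space UNIV) J (PiE J F)) =
          emeasure N (prod_emb UNIV (\<lambda>_. count_space UNIV) J (PiE J F))"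
      by (rule conjunct1[OF box[of n]]) (use n in \<open>fastforce simp: prod_emb_def PiE_iff\<close>)
  qed
qed

lemma markov_measure_exists:
  fixes p :: "real ^ 'w" and P :: "real ^ 'w ^ 'w"
  assumes p: "prob_vector p" and P: "right_stochastic P"
  shows "\<exists>M. is_markov_measure p P M"
proof -
  have pmf_ex: "\<exists>q. \<forall>w. pmf q w = r $ w" if "prob_vector r" for r :: "real ^ 'w"
  proof -
    have "(\<integral>\<^sup>+ w. ennreal (r $ w) \<partial>count_space UNIV) = ennreal (\<Sum>w\<in>UNIV. r $ w)"
      using that by (subst nn_integral_count_space_finite) (auto simp: prob_vector_def sum_ennreal)
    then have "pmf (embed_pmf (\<lambda>w. r $ w)) w = r $ w" for w
      using that by (intro pmf_embed_pmf) (auto simp: prob_vector_def)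
    then show ?thesis by blast
  qed
  obtain q where q: "\<And>w. pmf q w = p $ w"
    using pmf_ex[OF p] by blast
  have "\<forall>w. \<exists>q. \<forall>w'. pmf q w' = P $ w $ w'"
    using pmf_ex P by (auto simp: right_stochastic_def)
  then obtain Q where Q: "\<And>w w'. pmf (Q w) w' = P $ w $ w'"
    by metis
  define Mc :: "nat \<Rightarrow> 'w measure" where "Mc = (\<lambda>_. count_space UNIV)"
  define K where "K i x = measure_pmf (case i of 0 \<Rightarrow> q | Suc k \<Rightarrow> Q (x k))" for i and x :: "nat \<Rightarrow> 'w"
  have Km: "K i \<in> measurable (PiM {0..<i} Mc) (subprob_algebra (Mc i))" for i
  proof (cases i)
    case 0
    have "K i = (\<lambda>_. measure_pmf q)"
      by (simp add: K_def 0 fun_eq_iff)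
    then show ?thesis
      by (simp add: Mc_def measure_pmf_in_subprob_algebra)
  next
    case (Suc k)
    have "(\<lambda>x. x k) \<in> measurable (PiM {0..<i} Mc) (Mc k)"
      by (rule measurable_component_singleton) (simp add: Suc)
    moreover have "(\<lambda>y. measure_pmf (Q y)) \<in> measurable (Mc k) (subprob_algebra (Mc i))"
      by (auto simp: Mc_def measure_pmf_in_subprob_algebra)
    ultimately show ?thesis
      unfolding K_def Suc by (simp add: measurable_compose)
  qed
  interpret IT: Ionescu_Tulcea K Mc
    by standard (use Km in \<open>auto simp: K_def prob_space_measure_pmf\<close>)
  define u where "u = (\<lambda>_::nat. undefined :: 'w)"
  have u: "u \<in> space (PiM {0..<0} Mc)"
    by (simp add: space_PiM u_def)
  define f where "f v n = (case n of 0 \<Rightarrow> 1 | Suc k \<Rightarrow> p $ v 0 * (\<Prod>i<k. P $ v i $ v (Suc i)))"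
    for v :: "nat \<Rightarrow> 'w" and n
  have sing: "{restrict v {0..<n}} \<in> sets (PiM {0..<n} Mc)" for v n
  proof -
    have "{restrict v {0..<n}} = PiE {0..<n} (\<lambda>i. {v i})"
      by (auto simp: PiE_singleton extensional_def restrict_def fun_eq_iff PiE_iff)
    also have "\<dots> \<in> sets (PiM {0..<n} Mc)"
      by (intro sets_PiM_I_finite) (auto simp: Mc_def)
    finally show ?thesis .
  qed
  have C: "emeasure (IT.C 0 n u) {restrict v {0..<n}} = ennreal (f v n)" for v n
  proof (induction n)
    case 0
    have "{restrict v {0..<0}} = {u}"
      by (simp add: u_def restrict_def)
    moreover have "{u} \<in> sets (PiM {0..<0} Mc)"
      using sing[of v 0] by (simp add: u_def restrict_def)
    ultimately show ?case
      unfolding IT.C.simps by (simp only: emeasure_return) (simp add: f_def)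
  next
    case (Suc n)
    let ?S = "{restrict v {0..<Suc n}}" and ?T = "{restrict v {0..<n}}"
    have eP: "emeasure (IT.eP n x) ?S = ennreal (pmf (case n of 0 \<Rightarrow> q | Suc k \<Rightarrow> Q (v k)) (v n)) * indicator ?T x"
      if x: "x \<in> space (PiM {0..<n} Mc)" for x
    proof -
      have e: "emeasure (IT.eP n x) ?S = K n x ((\<lambda>y. x(n := y)) -` ?S \<inter> space (Mc n))"
        by (rule IT.emeasure_eP[OF x sing])
      have ext: "x \<in> extensional {0..<n}"
        using x by (simp add: space_PiM PiE_def)
      show ?thesis
      proof (cases "x = restrict v {0..<n}")
        case True
        then have "x(n := y) = restrict v {0..<Suc n} \<longleftrightarrow> y = v n" for y
          by (auto simp: fun_eq_iff restrict_def less_Suc_eq)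
        then have "(\<lambda>y. x(n := y)) -` ?S \<inter> space (Mc n) = {v n}"
          by (auto simp: Mc_def)
        moreover have "K n x = measure_pmf (case n of 0 \<Rightarrow> q | Suc k \<Rightarrow> Q (v k))"
          by (auto simp: K_def True split: nat.split)
        moreover have "indicator ?T x = (1 :: ennreal)"
          using True by simp
        ultimately show ?thesis
          unfolding e by (simp only: emeasure_pmf_single mult_1_right)
      next
        case False
        then obtain i where i: "x i \<noteq> restrict v {0..<n} i"
          by (auto simp: fun_eq_iff)
        then have "i < n"
          using ext by (cases "i < n") (auto simp: extensional_def)
        then have "x(n := y) \<noteq> restrict v {0..<Suc n}" for y
          using i by (auto simp: fun_eq_iff intro!: exI[of _ i])
        then have "(\<lambda>y. x(n := y)) -` ?S \<inter> space (Mc n) = {}"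
          by auto
        moreover have "indicator ?T x = (0 :: ennreal)"
          using False by simp
        ultimately show ?thesis
          unfolding e by (simp only: emeasure_empty mult_zero_right)
      qed
    qed
    have spC: "space (IT.C 0 n u) = space (PiM {0..<n} Mc)"
      using IT.space_C[OF u, of n] by simp
    have seC: "sets (IT.C 0 n u) = sets (PiM {0..<n} Mc)"
      using IT.sets_C[OF u, of n] by simp
    have ne: "space (IT.C 0 n u) \<noteq> {}"
      using prob_space.not_empty[OF IT.prob_space_C[OF u]] .
    have "emeasure (IT.C 0 (Suc n) u) ?S = (\<integral>\<^sup>+x. emeasure (IT.eP n x) ?S \<partial>IT.C 0 n u)"
      using IT.measurable_eP[of n] sing[of v "Suc n"]
      by (simp, subst emeasure_bind[OF ne]) (auto simp: measurable_cong_sets[OF seC refl])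
    also have "\<dots> = (\<integral>\<^sup>+x. ennreal (pmf (case n of 0 \<Rightarrow> q | Suc k \<Rightarrow> Q (v k)) (v n)) * indicator ?T x \<partial>IT.C 0 n u)"
      by (intro nn_integral_cong) (simp add: eP spC)
    also have "\<dots> = ennreal (pmf (case n of 0 \<Rightarrow> q | Suc k \<Rightarrow> Q (v k)) (v n)) * ennreal (f v n)"
      using sing[of v n] by (subst nn_integral_cmult_indicator) (auto simp: seC Suc.IH)
    also have "\<dots> = ennreal (pmf (case n of 0 \<Rightarrow> q | Suc k \<Rightarrow> Q (v k)) (v n) * f v n)"
      by (rule ennreal_mult'[symmetric]) simp
    also have "pmf (case n of 0 \<Rightarrow> q | Suc k \<Rightarrow> Q (v k)) (v n) * f v n = f v (Suc n)"
      by (cases n) (auto simp: f_def q Q)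
    finally show ?case .
  qed
  have "is_markov_measure p P IT.PF.lim"
    unfolding is_markov_measure_def
  proof (intro conjI allI)
    show "sets IT.PF.lim = sets (PiM UNIV (\<lambda>_. count_space UNIV))"
      using IT.PF.sets_lim unfolding Mc_def .
  next
    fix n and v :: "nat \<Rightarrow> 'w"
    let ?S = "{restrict v {0..<Suc n}}"
    have "(\<forall>i\<le>n. w i = v i) \<longleftrightarrow> restrict w {0..<Suc n} = restrict v {0..<Suc n}" for w
      by (metis atLeast0LessThan lessThan_iff less_Suc_eq_le restrict_apply' restrict_ext)
    then have "{w. \<forall>i\<le>n. w i = v i} = prod_emb UNIV Mc {0..<Suc n} ?S"
      by (auto simp: prod_emb_def Mc_def simp del: restrict_apply)
    then have "emeasure IT.PF.lim {w. \<forall>i\<le>n. w i = v i} = emeasure (IT.CI {0..<Suc n}) ?S"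
      using IT.lim[OF _ sing, of "Suc n" v] by simp
    also have "\<dots> = emeasure (IT.C 0 (Suc n) u) (prod_emb {0..<Suc n} Mc {0..<Suc n} ?S)"
      unfolding u_def by (rule IT.emeasure_CI[OF order_refl sing])
    also have "prod_emb {0..<Suc n} Mc {0..<Suc n} ?S = ?S"
      by (rule prod_emb_id) (auto simp: Mc_def)
    also have "emeasure (IT.C 0 (Suc n) u) ?S = ennreal (p $ v 0 * (\<Prod>i<n. P $ v i $ v (Suc i)))"
      by (simp only: C) (simp add: f_def)
    finally show "emeasure IT.PF.lim {w. \<forall>i\<le>n. w i = v i} =
        ennreal (p $ v 0 * (\<Prod>i<n. P $ v i $ v (Suc i)))" .
  qed
  then show ?thesis ..
qed

lemma markov_measure:
  assumes "prob_vector p" and "right_stochastic P"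
  shows "is_markov_measure p P (markov_measure p P)"
  unfolding markov_measure_def
  using markov_measure_exists[OF assms] markov_measure_unique by (metis theI)

subsection \<open>Quantum trajectories\<close>

primrec rho_traj ::
  "('w \<Rightarrow> complex ^ 'n ^ 'n \<Rightarrow> complex ^ 'n ^ 'n) \<Rightarrow> ('w \<Rightarrow> complex ^ 'n ^ 'n) \<Rightarrow>
   (nat \<Rightarrow> 'w) \<Rightarrow> nat \<Rightarrow> complex ^ 'n ^ 'n" where
  "rho_traj L \<rho> w 0 = \<rho> (w 0)"
| "rho_traj L \<rho> w (Suc n) = L (w (Suc n)) (rho_traj L \<rho> w n)"

text \<open>The composition of the dual maps at times \<open>1, \<dots>, n\<close>, the one at time \<open>n\<close> being applied first.\<close>

primrec heisenberg ::
  "('w \<Rightarrow> complex ^ 'n ^ 'n \<Rightarrow> complex ^ 'n ^ 'n) \<Rightarrow> (nat \<Rightarrow> 'w) \<Rightarrow> nat \<Rightarrow>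
   complex ^ 'n ^ 'n \<Rightarrow> complex ^ 'n ^ 'n" where
  "heisenberg L w 0 A = A"
| "heisenberg L w (Suc n) A = heisenberg L w n (dual_map (L (w (Suc n))) A)"

definition ergodic_mean :: "(nat \<Rightarrow> 'a) \<Rightarrow> nat \<Rightarrow> 'a::real_vector" where
  "ergodic_mean a N = (1 / real N) *\<^sub>R (\<Sum>n<N. a n)"

text \<open>
  Convergence in the Bochner space \<open>L\<^sup>1\<close> of a finite-dimensional space with the norm \<open>nrm\<close>;
  integrability does not depend on the choice of the norm.
\<close>

definition L1_tendsto ::
  "('b \<Rightarrow> real) \<Rightarrow> 'a measure \<Rightarrow> (nat \<Rightarrow> 'a \<Rightarrow> 'b::euclidean_space) \<Rightarrow> ('a \<Rightarrow> 'b) \<Rightarrow> bool" where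
  "L1_tendsto nrm M f g \<longleftrightarrow> (\<forall>N. integrable M (f N)) \<and> integrable M g \<and>
     (\<lambda>N. LINT x|M. nrm (f N x - g x)) \<longlonglongrightarrow> 0"

end

theory Submission
  imports Defs "HOL-Library.Discrete_Functions"
begin

text \<open>
  Irreducibility makes every nonzero fixed point of the extended map in the cone an interior point,
  so the fixed points are the multiples of one faithful state \<open>Rp\<close>; hence every \<open>X\<close> can be written as
  \<open>c 1 + Y - \<Phi> Y\<close> with \<open>c\<close> the pairing of \<open>Rp\<close> with \<open>X\<close> and \<open>\<Phi>\<close> the dual of the extended map.  Since
  \<open>\<Phi>\<close> averages over the next step of the chain, the pairings of \<open>\<rho>\<^sub>n\<close> with \<open>X(\<omega>\<^sub>n\<^sub>+\<^sub>1)\<close> are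
  \<open>c\<close> plus a bounded telescoping sequence plus bounded martingale differences, whose means tend to zero.
  The operator statement follows by testing on the rank one states, which determine a matrix by
  polarization.  In the primitive case a power of the extended map dominates a multiple of \<open>Rp\<close> on
  all states and hence contracts them towards \<open>Rp\<close>.
\<close>

subsection \<open>Quadratic forms of matrices\<close>

text \<open>The initial law is arbitrary and the averages involve products of random maps, so the
  ergodic theorem for a stationary shift does not apply as it stands; the Poisson equation reduces
  the claim to a law of large numbers for bounded orthogonal increments. As the environment is
  finite, whatever is observed up to a finite time is a finite combination of cylinder indicators,
  and conditional expectations become sums over the next coordinate. Irreducibility allows periodic
  behaviour, hence the time averages; primitivity excludes it. The Poisson equation requires the
  fixed points among all complex families, not only among states, while the types carry real vector
  space structures. A fixed point is therefore split as R = H + \<i> K with \<open>H\<close> and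
  \<open>K\<close> of real quadratic form, the interior point argument handles each, and
  \<open>ext_cmul\<close> recombines them. Existence of a steady state comes from Brouwer's theorem.
  Run on the states with prescribed traces, the same theorem lifts every invariant vector of
  \<open>P\<close> to a steady state, so uniqueness of the latter gives uniqueness of the
  former.\<close>

definition qform :: "complex ^ 'n \<Rightarrow> complex ^ 'n ^ 'n \<Rightarrow> complex" where
  "qform v A = cinner v (A *v v)"

lemma qform_eq: "qform v A = (\<Sum>i\<in>UNIV. \<Sum>j\<in>UNIV. cnj (v $ i) * A $ i $ j * v $ j)"
  by (simp add: qform_def cinner_def matrix_vector_mult_def sum_distrib_left mult.assoc)

lemma qform_add: "qform v (A + B) = qform v A + qform v B"
  by (simp add: qform_eq ring_distribs sum.distrib)

lemma qform_scaleR: "qform v (r *\<^sub>R A) = of_real r * qform v A"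
  by (simp add: qform_eq sum_distrib_left scaleR_conv_of_real[where 'a=complex] ac_simps)

lemma qform_cmul: "qform v (map_matrix ((*) c) A) = c * qform v A"
  by (simp add: qform_eq sum_distrib_left ac_simps)

lemma linear_qform: "linear (qform v)"
  by (rule linearI) (auto simp: qform_add qform_scaleR scaleR_conv_of_real[where 'a=complex])

lemmas qform_diff = linear_diff[OF linear_qform]
  and qform_sum = linear_sum[OF linear_qform]

lemma qform_adjoint: "qform v (cadjoint A) = cnj (qform v A)"
  unfolding qform_eq cadjoint_def
  by (subst sum.swap) (simp add: transpose_def ac_simps)

lemma qform_scaleR_left: "qform (r *\<^sub>R v) A = of_real (r ^ 2) * qform v A"
  by (simp add: qform_eq sum_distrib_left scaleR_conv_of_real[where 'a=complex] power2_eq_square ac_simps)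

lemma cnj_mult_sum: "(\<Sum>i\<in>UNIV. cnj (v $ i) * v $ i) = of_real ((norm v)\<^sup>2)"
  for v :: "complex ^ 'n"
  by (simp add: norm_vec_def L2_set_def sum_nonneg mult.commute[of "cnj _"] flip: complex_norm_square)

lemma qform_mat: "qform v (mat c) = c * of_real ((norm v)\<^sup>2)"
proof -
  have "qform v (mat c) = (\<Sum>i\<in>UNIV. \<Sum>j\<in>UNIV. if i = j then c * (cnj (v $ i) * v $ j) else 0)"
    unfolding qform_eq by (intro sum.cong refl) (auto simp: mat_def)
  also have "\<dots> = c * (\<Sum>i\<in>UNIV. cnj (v $ i) * v $ i)"
    by (simp add: sum_distrib_left)
  finally show ?thesis
    by (simp only: cnj_mult_sum)
qed

lemma qform_axis_pair:
  "qform (axis i 1 + axis j z) A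
    = A $ i $ i + cnj z * z * A $ j $ j + z * A $ i $ j + cnj z * A $ j $ i"
proof -
  have 1: "cinner (axis i a + axis j b) u = cnj a * u $ i + cnj b * u $ j" for a b u
  proof -
    have "cinner (axis i a + axis j b) u
      = (\<Sum>k\<in>UNIV. (if k = i then cnj a * u $ k else 0) + (if k = j then cnj b * u $ k else 0))"
      unfolding cinner_def by (intro sum.cong refl) (auto simp: axis_def ring_distribs)
    then show ?thesis by (simp add: sum.distrib)
  qed
  have 2: "(A *v axis j z) $ k = A $ k $ j * z" for k j z
  proof -
    have "(A *v axis j z) $ k = (\<Sum>l\<in>UNIV. if l = j then A $ k $ l * z else 0)"
      unfolding matrix_vector_mult_def vec_lambda_beta by (intro sum.cong refl) (auto simp: axis_def)
    then show ?thesis by simp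
  qed
  show ?thesis
    by (simp add: qform_def 1 2 matrix_vector_right_distrib algebra_simps)
qed

lemma qform_axis: "qform (axis i 1) A = A $ i $ i"
  using qform_axis_pair[of i i 0 A] by (simp add: axis_def vec_eq_iff flip: zero_vec_def)

text \<open>In the form at e_i + \<i> e_j the entries \<open>A $ i $ j\<close> and
  \<open>A $ j $ i\<close> carry the factors \<i> and -\<i>; after multiplication by -\<i> the first
  adds to, and the second cancels against, its copy in the form at e_i + e_j.\<close>

lemma qform_polarization:
  "A $ i $ j = (qform (axis i 1 + axis j 1) A - \<i> * qform (axis i 1 + axis j \<i>) A
     - (1 - \<i>) * (qform (axis i 1) A + qform (axis j 1) A)) / 2"
  by (simp add: qform_axis_pair qform_axis algebra_simps)

lemma qform_eqI:
  assumes "\<And>v. qform v A = qform v B"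
  shows "A = B"
  unfolding vec_eq_iff using assms by (subst (1 2) qform_polarization) simp

lemma psd_iff: "psd A \<longleftrightarrow> (\<forall>v. 0 \<le> Re (qform v A) \<and> Im (qform v A) = 0)"
  by (simp add: psd_def qform_def complex_nonneg_Reals_iff)

lemma pos_def_iff: "pos_def A \<longleftrightarrow> (\<forall>v. v \<noteq> 0 \<longrightarrow> 0 < Re (qform v A) \<and> Im (qform v A) = 0)"
  by (auto simp: pos_def_def qform_def complex_nonneg_Reals_iff complex_eq_iff less_le)

lemma psd_diag: "psd A \<Longrightarrow> 0 \<le> Re (A $ i $ i) \<and> Im (A $ i $ i) = 0"
  using psd_iff qform_axis by metis

lemma psd_trace_nonneg: "psd A \<Longrightarrow> 0 \<le> Re (trace A)"
  by (simp add: trace_def sum_nonneg psd_diag)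

text \<open>For |z| = 1 the forms at e_i + z e_j and e_i - z e_j are nonnegative with sum 2 s, so
  each lies within s of s. Polarization with z = 1 and z = \<i> bounds the entry by s, which is at
  most twice the trace.\<close>

lemma psd_entry_le:
  assumes "psd A"
  shows "norm (A $ i $ j) \<le> 2 * Re (trace A)"
proof -
  define s where "s = A $ i $ i + A $ j $ j"
  have diag: "Re (A $ k $ k) \<le> Re (trace A)" for k
    using member_le_sum[of k UNIV "\<lambda>k. Re (A $ k $ k)"] psd_diag[OF assms] by (simp add: trace_def)
  have s: "Re s \<le> 2 * Re (trace A)" "Im s = 0"
    using diag[of i] diag[of j] psd_diag[OF assms, of i] psd_diag[OF assms, of j] by (auto simp: s_def)
  have q: "norm (qform (axis i 1 + axis j z) A - s) \<le> Re s" if z: "cnj z * z = 1" for z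
  proof -
    have "qform (axis i 1 + axis j z) A + qform (axis i 1 + axis j (- z)) A = 2 * s"
      using z by (simp add: qform_axis_pair s_def)
    moreover have "0 \<le> Re (qform (axis i 1 + axis j z) A)" "Im (qform (axis i 1 + axis j z) A) = 0"
      "0 \<le> Re (qform (axis i 1 + axis j (- z)) A)"
      using assms by (auto simp: psd_iff)
    ultimately show ?thesis
      using s by (auto simp: complex_eq_iff cmod_eq_Re)
  qed
  have "2 * A $ i $ j = (qform (axis i 1 + axis j 1) A - s) - \<i> * (qform (axis i 1 + axis j \<i>) A - s)"
    by (simp add: qform_axis_pair s_def algebra_simps)
  then have "norm (2 * A $ i $ j) \<le> norm (qform (axis i 1 + axis j 1) A - s)
      + norm (\<i> * (qform (axis i 1 + axis j \<i>) A - s))"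
    by (simp only: norm_triangle_ineq4)
  also have "\<dots> \<le> Re s + Re s"
    using q[of 1] q[of "\<i>"] by (intro add_mono) (auto simp: norm_mult)
  finally show ?thesis
    using s by (simp add: norm_mult)
qed

lemma norm_qform_le: "norm (qform v A) \<le> (\<Sum>i\<in>UNIV. \<Sum>j\<in>UNIV. norm (A $ i $ j)) * (norm v)\<^sup>2"
proof -
  have "norm (qform v A) \<le> (\<Sum>i\<in>UNIV. \<Sum>j\<in>UNIV. norm (cnj (v $ i) * A $ i $ j * v $ j))"
    unfolding qform_eq by (intro sum_norm_le order_trans[OF norm_sum] order_refl)
  also have "\<dots> \<le> (\<Sum>i\<in>UNIV. \<Sum>j\<in>UNIV. norm (A $ i $ j) * (norm v)\<^sup>2)"
  proof (intro sum_mono)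
    fix i j
    have "norm (v $ i) * norm (v $ j) \<le> norm v * norm v"
      by (intro mult_mono Finite_Cartesian_Product.norm_nth_le) auto
    then show "norm (cnj (v $ i) * A $ i $ j * v $ j) \<le> norm (A $ i $ j) * (norm v)\<^sup>2"
      using mult_left_mono[of "norm (v $ i) * norm (v $ j)" "norm v * norm v" "norm (A $ i $ j)"]
      by (simp add: norm_mult power2_eq_square ac_simps)
  qed
  finally show ?thesis
    by (simp add: sum_distrib_right)
qed

lemma continuous_on_qform [continuous_intros]:
  assumes "continuous_on S f" "continuous_on S g"
  shows "continuous_on S (\<lambda>x. qform (f x) (g x))"
  unfolding qform_eq by (intro continuous_intros assms)

text \<open>The rank one operator v v^*, an unnormalized pure state. Pairing with it evaluates the
  quadratic form at \<open>v\<close>, which turns statements on operators into statements on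
  trajectories.\<close>

definition proj :: "complex ^ 'n \<Rightarrow> complex ^ 'n ^ 'n" where
  "proj v = (\<chi> i j. v $ i * cnj (v $ j))"

lemma hs_pairing_proj: "hs_pairing (proj v) A = qform v A"
  unfolding hs_pairing_eq qform_eq proj_def by (subst sum.swap) (simp add: ac_simps)

lemma trace_proj: "trace (proj v) = of_real ((norm v)\<^sup>2)"
  using cnj_mult_sum[of v] by (simp add: trace_def proj_def ac_simps)

lemma psd_proj: "psd (proj v)"
proof -
  have "qform u (proj v) = cnj (cinner v u) * cinner v u" for u
    unfolding qform_eq cinner_def proj_def cnj_sum sum_product by (simp add: ac_simps)
  then have "qform u (proj v) = of_real ((norm (cinner v u))\<^sup>2)" for u
    by (simp only: complex_norm_square mult.commute)
  then show ?thesis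
    by (simp add: psd_iff)
qed

section \<open>Linearity and size of the trace pairing\<close>

lemma hs_pairing_diff_right: "hs_pairing R (X - Y) = hs_pairing R X - hs_pairing R Y"
  and hs_pairing_add_right: "hs_pairing R (X + Y) = hs_pairing R X + hs_pairing R Y"
  and hs_pairing_scaleR_right: "hs_pairing R (r *\<^sub>R X) = of_real r * hs_pairing R X"
  and hs_pairing_add_left: "hs_pairing (R + S) X = hs_pairing R X + hs_pairing S X"
  and hs_pairing_scaleR_left: "hs_pairing (r *\<^sub>R R) X = of_real r * hs_pairing R X"
  and hs_pairing_cmul_left: "hs_pairing (map_matrix ((*) c) R) X = cnj c * hs_pairing R X"
  by (simp_all add: hs_pairing_eq ring_distribs sum.distrib sum_subtractf sum_distrib_left
      scaleR_conv_of_real[where 'a=complex] ac_simps)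

lemma linear_hs_pairing_right: "linear (hs_pairing R)"
  by (rule linearI) (auto simp: hs_pairing_add_right hs_pairing_scaleR_right scaleR_conv_of_real[where 'a=complex])

lemma linear_hs_pairing_left: "linear (\<lambda>R. hs_pairing R X)"
  by (rule linearI) (auto simp: hs_pairing_add_left hs_pairing_scaleR_left scaleR_conv_of_real[where 'a=complex])

lemma hs_pairing_mat: "hs_pairing R (mat c) = cnj (trace R) * c"
proof -
  have "hs_pairing R (mat c) = (\<Sum>i\<in>UNIV. \<Sum>j\<in>UNIV. if j = i then cnj (R $ j $ i) * c else 0)"
    unfolding hs_pairing_eq by (intro sum.cong refl) (auto simp: mat_def)
  then show ?thesis
    by (simp add: trace_def sum_distrib_right)
qed

text \<open>Links the complex pairing to the real inner product of the type, for which adjoints and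
  orthogonal complements are available.\<close>

lemma Re_hs_pairing: "Re (hs_pairing R X) = inner R X"
  unfolding hs_pairing_eq inner_vec_def by (subst sum.swap) (simp add: inner_complex_def)

text \<open>A bound by the trace is uniform in time along a trajectory, since the channels preserve
  the trace.\<close>

lemma norm_hs_pairing_psd_le:
  assumes "psd R"
  shows "norm (hs_pairing R X) \<le> 2 * Re (trace R) * (\<Sum>i\<in>UNIV. \<Sum>j\<in>UNIV. norm (X $ j $ i))"
proof -
  have "norm (hs_pairing R X) \<le> (\<Sum>i\<in>UNIV. \<Sum>j\<in>UNIV. norm (cnj (R $ j $ i) * X $ j $ i))"
    unfolding hs_pairing_eq by (intro sum_norm_le order_trans[OF norm_sum] order_refl)
  also have "\<dots> \<le> (\<Sum>i\<in>UNIV. \<Sum>j\<in>UNIV. 2 * Re (trace R) * norm (X $ j $ i))"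
    using psd_entry_le[OF assms] by (intro sum_mono) (simp add: norm_mult mult_right_mono)
  finally show ?thesis
    by (simp add: sum_distrib_left)
qed

subsection \<open>The cone of the extended algebra\<close>

definition ext_trace :: "complex ^ 'n ^ 'n ^ 'w \<Rightarrow> complex" where
  "ext_trace R = (\<Sum>w\<in>UNIV. trace (R $ w))"

lemma extended_state_iff: "extended_state R \<longleftrightarrow> ext_nonneg R \<and> ext_trace R = 1"
  by (simp add: extended_state_def ext_trace_def)

lemma trace_scaleR: "trace (r *\<^sub>R A) = of_real r * trace (A :: complex ^ 'n ^ 'n)"
  by (simp add: trace_def sum_distrib_left scaleR_conv_of_real[where 'a=complex])

lemma linear_trace: "linear (trace :: complex ^ 'n ^ 'n \<Rightarrow> complex)"
  by (rule linearI) (auto simp: trace_add trace_scaleR scaleR_conv_of_real[where 'a=complex])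

lemma trace_sum: "trace (sum f S) = (\<Sum>s\<in>S. trace (f s :: complex ^ 'n ^ 'n))"
  by (rule linear_sum[OF linear_trace])

lemma linear_ext_trace: "linear (ext_trace :: complex ^ 'n ^ 'n ^ 'w \<Rightarrow> complex)"
  by (rule linearI) (auto simp: ext_trace_def trace_add trace_scaleR sum.distrib
      scaleR_conv_of_real[where 'a=complex] sum_distrib_left)

lemmas ext_trace_add = linear_add[OF linear_ext_trace]
  and ext_trace_diff = linear_diff[OF linear_ext_trace]
  and ext_trace_scaleR = linear_scale[OF linear_ext_trace]

lemma ext_nonneg_iff:
  "ext_nonneg R \<longleftrightarrow> (\<forall>w v. 0 \<le> Re (qform v (R $ w)) \<and> Im (qform v (R $ w)) = 0)"
  by (auto simp: ext_nonneg_def psd_iff)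

lemma faithful_iff:
  "faithful R \<longleftrightarrow> (\<forall>w v. v \<noteq> 0 \<longrightarrow> 0 < Re (qform v (R $ w)) \<and> Im (qform v (R $ w)) = 0)"
  by (auto simp: faithful_def pos_def_iff)

lemma ext_nonneg_add: "ext_nonneg R \<Longrightarrow> ext_nonneg S \<Longrightarrow> ext_nonneg (R + S)"
  by (simp add: ext_nonneg_iff qform_add)

lemma ext_nonneg_scaleR: "ext_nonneg R \<Longrightarrow> 0 \<le> r \<Longrightarrow> ext_nonneg (r *\<^sub>R R)"
  by (simp add: ext_nonneg_iff qform_scaleR)

lemma norm_vec_le_sum: "norm x \<le> (\<Sum>i\<in>UNIV. norm (x $ i))"
  by (simp add: norm_vec_def L2_set_le_sum)

text \<open>On the cone the trace controls every entry. This makes the set of states compact and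
  forces elements of trace zero to vanish.\<close>

lemma norm_ext_nonneg_le:
  fixes R :: "complex ^ 'n ^ 'n ^ 'w"
  assumes "ext_nonneg R"
  shows "norm (R $ w $ i $ j) \<le> 2 * Re (ext_trace R)"
    and "norm R \<le> (\<Sum>w\<in>(UNIV :: 'w set). \<Sum>i\<in>(UNIV :: 'n set). \<Sum>j\<in>(UNIV :: 'n set). 2 * Re (ext_trace R))"
proof -
  show *: "norm (R $ w $ i $ j) \<le> 2 * Re (ext_trace R)" for w i j
  proof -
    have "norm (R $ w $ i $ j) \<le> 2 * Re (trace (R $ w))"
      using assms by (simp add: ext_nonneg_def psd_entry_le)
    also have "Re (trace (R $ w)) \<le> Re (ext_trace R)"
      using member_le_sum[of w UNIV "\<lambda>w. Re (trace (R $ w))"] assms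
      by (simp add: ext_trace_def ext_nonneg_def psd_trace_nonneg)
    finally show ?thesis by simp
  qed
  have "norm R \<le> (\<Sum>w\<in>UNIV. \<Sum>i\<in>UNIV. \<Sum>j\<in>UNIV. norm (R $ w $ i $ j))"
    by (intro order_trans[OF norm_vec_le_sum] sum_mono order_refl)
  also have "\<dots> \<le> (\<Sum>w\<in>(UNIV :: 'w set). \<Sum>i\<in>(UNIV :: 'n set). \<Sum>j\<in>(UNIV :: 'n set). 2 * Re (ext_trace R))"
    by (intro sum_mono *)
  finally show "norm R \<le> \<dots>" .
qed

lemma ext_nonneg_zero: "ext_nonneg R \<Longrightarrow> ext_trace R = 0 \<Longrightarrow> R = 0"
  using norm_ext_nonneg_le(2)[of R] by simp

lemma closed_ext_nonneg: "closed {R :: complex ^ 'n ^ 'n ^ 'w. ext_nonneg R}"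
  unfolding ext_nonneg_iff
  by (intro closed_Collect_all closed_Collect_conj closed_Collect_le closed_Collect_eq
      continuous_intros)

lemma closed_extended_states: "closed {R :: complex ^ 'n ^ 'n ^ 'w. extended_state R}"
  unfolding extended_state_iff
  by (intro closed_Collect_conj closed_ext_nonneg closed_Collect_eq continuous_intros
      linear_continuous_on linear_conv_bounded_linear[THEN iffD1] linear_ext_trace)

lemma compact_extended_states: "compact {R :: complex ^ 'n ^ 'n ^ 'w. extended_state R}"
  unfolding compact_eq_bounded_closed
  by (intro conjI closed_extended_states boundedI) (auto simp: extended_state_iff dest!: norm_ext_nonneg_le(2))

text \<open>The form attains a positive minimum on \<open>K\<close> times the unit sphere;
  homogeneity of degree two extends the bound to all \<open>v\<close>, and the least of the finitely
  many constants serves every \<open>w\<close>.\<close>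

lemma faithful_compact_bound:
  fixes K :: "(complex ^ 'n ^ 'n ^ 'w) set"
  assumes K: "compact K" and pos: "\<And>R. R \<in> K \<Longrightarrow> faithful R"
  obtains d where "d > 0" "\<And>R w v. R \<in> K \<Longrightarrow> d * (norm v)\<^sup>2 \<le> Re (qform v (R $ w))"
proof (cases "K = {}")
  case True
  then show ?thesis using that[of 1] by simp
next
  case False
  have "\<exists>d>0. \<forall>R\<in>K. \<forall>v\<in>sphere 0 1. d \<le> Re (qform v (R $ w))" for w
  proof -
    have "compact (K \<times> sphere (0 :: complex ^ 'n) 1)"
      using K by (intro compact_Times compact_sphere)
    moreover have "axis undefined 1 \<in> sphere (0 :: complex ^ 'n) 1"
      by (simp add: norm_axis_1)
    then have "K \<times> sphere (0 :: complex ^ 'n) 1 \<noteq> {}"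
      using False by blast
    moreover have "continuous_on (K \<times> sphere (0 :: complex ^ 'n) 1) (\<lambda>x. Re (qform (snd x) (fst x $ w)))"
      by (intro continuous_intros)
    ultimately obtain x where x: "x \<in> K \<times> sphere 0 1"
      and min: "\<forall>y\<in>K \<times> sphere (0 :: complex ^ 'n) 1. Re (qform (snd x) (fst x $ w)) \<le> Re (qform (snd y) (fst y $ w))"
      using continuous_attains_inf by blast
    moreover have "0 < Re (qform (snd x) (fst x $ w))"
      using x pos[of "fst x"] by (cases "snd x = 0") (auto simp: faithful_iff)
    ultimately show ?thesis
      by (intro exI[of _ "Re (qform (snd x) (fst x $ w))"]) force
  qed
  then obtain d where d: "\<And>w. d w > 0" "\<And>w R v. R \<in> K \<Longrightarrow> norm v = 1 \<Longrightarrow> d w \<le> Re (qform v (R $ w))"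
    by (metis mem_sphere_0)
  define e where "e = Min (range d)"
  have e: "e > 0" "e \<le> d w" for w
    using d(1) by (auto simp: e_def)
  show ?thesis
  proof (rule that[OF e(1)])
    fix R w and v :: "complex ^ 'n" assume R: "R \<in> K"
    show "e * (norm v)\<^sup>2 \<le> Re (qform v (R $ w))"
    proof (cases "v = 0")
      case False
      then have v: "v = norm v *\<^sub>R (v /\<^sub>R norm v)" "norm (v /\<^sub>R norm v) = 1"
        by auto
      have "Re (qform v (R $ w)) = (norm v)\<^sup>2 * Re (qform (v /\<^sub>R norm v) (R $ w))"
        by (subst v(1), subst qform_scaleR_left) simp
      moreover have "e \<le> Re (qform (v /\<^sub>R norm v) (R $ w))"
        using d(2)[OF R v(2)] e(2) order_trans by blast
      ultimately show ?thesis
        using mult_right_mono[of e "Re (qform (v /\<^sub>R norm v) (R $ w))" "(norm v)\<^sup>2"]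
        by (simp add: mult.commute)
    qed (simp add: qform_eq)
  qed
qed

lemma qform_bound:
  obtains M where "M > 0" "\<And>w v. \<bar>Re (qform v (B $ w))\<bar> \<le> M * (norm v)\<^sup>2"
proof -
  define m where "m w = (\<Sum>i\<in>UNIV. \<Sum>j\<in>UNIV. norm (B $ w $ i $ j))" for w
  have m0: "0 \<le> m w" for w
    by (simp add: m_def sum_nonneg)
  define M where "M = 1 + (\<Sum>w\<in>UNIV. m w)"
  have mM: "m w \<le> M" for w
    using member_le_sum[of w UNIV m] m0 by (simp add: M_def)
  show ?thesis
  proof
    show "M > 0" using m0 by (simp add: M_def sum_nonneg add_pos_nonneg)
    fix w v
    have "\<bar>Re (qform v (B $ w))\<bar> \<le> m w * (norm v)\<^sup>2"
      unfolding m_def by (rule order_trans[OF abs_Re_le_cmod norm_qform_le])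
    also have "\<dots> \<le> M * (norm v)\<^sup>2"
      by (intro mult_right_mono mM) simp
    finally show "\<bar>Re (qform v (B $ w))\<bar> \<le> M * (norm v)\<^sup>2" .
  qed
qed

text \<open>Faithful means interior to the cone within the families of real quadratic form: the form
  of \<open>A\<close> is at least d |v|^2 and that of \<open>B\<close> at most M |v|^2 in modulus,
  so e = d / M works.\<close>

lemma faithful_perturb:
  assumes A: "faithful A" and B: "\<And>w v. Im (qform v (B $ w)) = 0"
  obtains e where "e > 0" "ext_nonneg (A + e *\<^sub>R B)"
proof -
  obtain d where d: "d > 0" "\<And>w v. d * (norm v)\<^sup>2 \<le> Re (qform v (A $ w))"
    by (rule faithful_compact_bound[of "{A}"]) (use A in auto)
  obtain M where M: "M > 0" "\<And>w v. \<bar>Re (qform v (B $ w))\<bar> \<le> M * (norm v)\<^sup>2"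
    using qform_bound by blast
  have im: "Im (qform v (A $ w)) = 0" for w v
    using A by (cases "v = 0") (auto simp: faithful_iff qform_eq)
  have "0 \<le> Re (qform v (A $ w)) + d / M * Re (qform v (B $ w))" for w v
  proof -
    have "- (d / M * Re (qform v (B $ w))) \<le> d / M * (M * (norm v)\<^sup>2)"
      using M d unfolding mult_minus_right[symmetric] by (intro mult_left_mono) (auto simp: abs_le_iff)
    also have "\<dots> = d * (norm v)\<^sup>2" using M by simp
    finally show ?thesis using d(2)[of v w] by simp
  qed
  then have "ext_nonneg (A + (d / M) *\<^sub>R B)"
    using B im by (simp add: ext_nonneg_iff qform_add qform_scaleR)
  then show ?thesis using that[of "d / M"] d M by simp
qed

text \<open>The type only offers real scalars, but the fixed points of the extended map form a line
  over the complex numbers.\<close>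

definition ext_cmul :: "complex \<Rightarrow> complex ^ 'n ^ 'n ^ 'w \<Rightarrow> complex ^ 'n ^ 'n ^ 'w" where
  "ext_cmul c R = (\<chi> w. map_matrix ((*) c) (R $ w))"

lemma ext_pairing_cmul_left: "ext_pairing (ext_cmul c R) X = cnj c * ext_pairing R X"
  by (simp add: ext_pairing_def ext_cmul_def hs_pairing_cmul_left sum_distrib_left)

lemma Re_ext_pairing: "Re (ext_pairing R X) = inner R X"
  by (simp add: ext_pairing_def Re_hs_pairing inner_vec_def)

lemma linear_ext_pairing_right: "linear (ext_pairing R)"
  by (rule linearI) (auto simp: ext_pairing_def hs_pairing_add_right hs_pairing_scaleR_right
      scaleR_conv_of_real[where 'a=complex] sum.distrib sum_distrib_left)

lemma linear_ext_pairing_left: "linear (\<lambda>R. ext_pairing R X)"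
  by (rule linearI) (auto simp: ext_pairing_def hs_pairing_add_left hs_pairing_scaleR_left
      scaleR_conv_of_real[where 'a=complex] sum.distrib sum_distrib_left)

lemma ext_pairing_mat: "ext_pairing R (\<chi> w. mat c) = cnj (ext_trace R) * c"
  by (simp add: ext_pairing_def hs_pairing_mat ext_trace_def sum_distrib_right)

lemma exp_map_fixed:
  fixes R :: "'a :: real_normed_vector"
  assumes "\<Phi> R = R"
  shows "exp_map t \<Phi> R = exp t *\<^sub>R R"
proof -
  have "(\<Phi> ^^ k) R = R" for k
    using assms by (induction k) auto
  moreover have "(\<lambda>k. (t ^ k / fact k) *\<^sub>R R) sums (exp t *\<^sub>R R)"
    using exp_converges[of t] by (intro sums_scaleR_left) (simp add: divide_inverse mult.commute)
  ultimately show ?thesis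
    by (simp add: exp_map_def sums_iff)
qed

text \<open>A fixed point of \<Phi> is an eigenvector of the semigroup with the positive eigenvalue
  e^t, so positivity improvement at a single time makes the fixed point itself faithful.\<close>

lemma faithful_fixed:
  assumes "irreducible_map \<Phi>" "ext_nonneg R" "R \<noteq> 0" "\<Phi> R = R"
  shows "faithful R"
proof -
  obtain t where "positivity_improving (exp_map t \<Phi>)"
    using assms by (auto simp: irreducible_map_def)
  then have "faithful (exp t *\<^sub>R R)"
    using assms exp_map_fixed[of \<Phi> R t] by (metis positivity_improving_def)
  then show ?thesis
    by (simp add: faithful_iff qform_scaleR zero_less_mult_iff)
qed

subsection \<open>Steady states\<close>

locale environment_channels =
  fixes P :: "real ^ 'w ^ 'w" and L :: "'w \<Rightarrow> complex ^ 'n ^ 'n \<Rightarrow> complex ^ 'n ^ 'n"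
  assumes stochastic: "right_stochastic P" and cptp_L: "\<And>w. cptp (L w)"
begin

lemma P_nonneg: "0 \<le> P $ v $ w"
  and P_sum: "(\<Sum>w\<in>UNIV. P $ v $ w) = 1"
  using stochastic by (auto simp: right_stochastic_def prob_vector_def)

lemma clinear_L: "clinear_map (L w)"
  using cptp_L by (simp add: cptp_def completely_positive_def)

lemma L_cmul: "L w (map_matrix ((*) c) A) = map_matrix ((*) c) (L w A)"
  using clinear_L by (simp add: clinear_map_def)

lemma linear_L: "linear (L w)"
proof (rule linearI)
  show "L w (A + B) = L w A + L w B" for A B
    using clinear_L by (simp add: clinear_map_def)
  have *: "r *\<^sub>R A = map_matrix ((*) (of_real r)) A" for r and A :: "complex ^ 'n ^ 'n"
    by (simp add: vec_eq_iff scaleR_conv_of_real[where 'a=complex])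
  show "L w (r *\<^sub>R A) = r *\<^sub>R L w A" for r A
    unfolding * by (rule L_cmul)
qed

lemma trace_L: "trace (L w A) = trace A"
  using cptp_L by (simp add: cptp_def trace_preserving_def)

lemma psd_L:
  assumes "psd A"
  shows "psd (L w A)"
proof -
  \<comment> \<open>Complete positivity with a single block is positivity.\<close>
  have *: "block_psd 1 (\<lambda>i j. B) \<longleftrightarrow> psd B" for B :: "complex ^ 'n ^ 'n"
    unfolding block_psd_def psd_def by (auto dest: spec[of _ "\<lambda>_. v" for v])
  show ?thesis
    using cptp_L[of w] assms *
    unfolding cptp_def completely_positive_def by blast
qed

lemma linear_ext_map: "linear (ext_map P L)"
  by (rule linearI)
    (simp_all add: ext_map_def vec_eq_iff linear_add[OF linear_L] linear_scale[OF linear_L]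
      sum.distrib scaleR_sum_right scaleR_add_right mult.commute)

lemma ext_map_cmul: "ext_map P L (ext_cmul c R) = ext_cmul c (ext_map P L R)"
  by (simp add: ext_map_def ext_cmul_def L_cmul vec_eq_iff sum_distrib_left
      scaleR_conv_of_real[where 'a=complex] ac_simps)

lemma ext_map_nonneg: "ext_nonneg R \<Longrightarrow> ext_nonneg (ext_map P L R)"
  using psd_L P_nonneg unfolding ext_nonneg_def
  by (auto simp: ext_map_def psd_iff qform_sum qform_scaleR intro!: sum_nonneg)

lemma ext_trace_ext_map: "ext_trace (ext_map P L R) = ext_trace R"
proof -
  have "ext_trace (ext_map P L R) = (\<Sum>v\<in>UNIV. \<Sum>w\<in>UNIV. of_real (P $ v $ w) * trace (R $ v))"
    unfolding ext_trace_def by (subst sum.swap) (simp add: ext_map_def trace_sum trace_scaleR trace_L)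
  also have "\<dots> = ext_trace R"
    by (simp add: ext_trace_def P_sum flip: sum_distrib_right of_real_sum)
  finally show ?thesis .
qed

lemma extended_state_ext_map: "extended_state R \<Longrightarrow> extended_state (ext_map P L R)"
  by (simp add: extended_state_iff ext_map_nonneg ext_trace_ext_map)

lemma extended_state_funpow: "extended_state R \<Longrightarrow> extended_state ((ext_map P L ^^ n) R)"
  by (induction n) (auto simp: extended_state_ext_map)

lemma linear_funpow: "linear (ext_map P L ^^ n)"
  by (induction n) (simp_all only: funpow.simps linear_id linear_compose[OF _ linear_ext_map])

text \<open>Positivity forces preservation of real quadratic forms: the family \<open>I\<close> of
  identities and I + e H for small e > 0 lie in the cone, hence so do their images, and these differ
  by e times the image of \<open>H\<close>.\<close>

lemma ext_map_real_form:
  assumes "\<And>w v. Im (qform v (H $ w)) = 0"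
  shows "Im (qform v (ext_map P L H $ w)) = 0"
proof -
  define I :: "complex ^ 'n ^ 'n ^ 'w" where "I = (\<chi> w. mat 1)"
  have I: "faithful I" "ext_nonneg I"
    by (auto simp: faithful_iff ext_nonneg_iff I_def qform_mat)
  obtain e where e: "e > 0" "ext_nonneg (I + e *\<^sub>R H)"
    using faithful_perturb[OF I(1), of H] assms by blast
  have "ext_map P L (I + e *\<^sub>R H) = ext_map P L I + e *\<^sub>R ext_map P L H"
    by (simp add: linear_add[OF linear_ext_map] linear_scale[OF linear_ext_map])
  then have "ext_nonneg (ext_map P L I + e *\<^sub>R ext_map P L H)"
    using ext_map_nonneg[OF e(2)] by simp
  moreover have "ext_nonneg (ext_map P L I)"
    using I(2) by (rule ext_map_nonneg)
  ultimately show ?thesis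
    using e(1) by (auto simp: ext_nonneg_iff qform_add qform_scaleR)
qed

text \<open>Stated for any invariant closed convex set of states, because it is used both for all
  states and for those with prescribed traces.\<close>

lemma steady_state_in:
  assumes K: "closed K" "convex K" "K \<noteq> {}" "K \<subseteq> {R. extended_state R}"
    and inv: "\<And>R. R \<in> K \<Longrightarrow> ext_map P L R \<in> K"
  obtains R where "R \<in> K" "extended_steady_state P L R"
proof -
  have "compact K"
    using compact_Int_closed[OF compact_extended_states K(1)] K(4) by (simp add: Int_absorb1)
  then obtain R where "R \<in> K" "ext_map P L R = R"
    using brouwer[of K "ext_map P L"] K(2,3) inv
    by (metis Pi_I linear_continuous_on linear_conv_bounded_linear linear_ext_map)
  then show ?thesis
    using that K(4) by (auto simp: extended_steady_state_def)
qed

lemma convex_extended_states: "convex {R :: complex ^ 'n ^ 'n ^ 'w. extended_state R}"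
  unfolding convex_def extended_state_iff
  by (auto simp: ext_nonneg_add ext_nonneg_scaleR ext_trace_add ext_trace_scaleR
      scaleR_conv_of_real[where 'a=complex] simp flip: of_real_add)

text \<open>Brouwer's theorem, on the convex set of the states with the given traces.\<close>

lemma steady_state_of_invariant:
  assumes p: "invariant_prob_vector P p"
  obtains R where "extended_steady_state P L R" "\<And>w. trace (R $ w) = of_real (p $ w)"
proof -
  let ?K = "{R :: complex ^ 'n ^ 'n ^ 'w. extended_state R} \<inter> {R. \<forall>w. trace (R $ w) = of_real (p $ w)}"
  define v :: "complex ^ 'n" where "v = axis undefined 1"
  have v: "norm v = 1"
    by (simp add: v_def norm_axis_1)
  have p': "0 \<le> p $ w" "(\<Sum>w\<in>UNIV. p $ w) = 1" "(\<Sum>v\<in>UNIV. P $ v $ w * p $ v) = p $ w" for w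
    using p by (auto simp: invariant_prob_vector_def prob_vector_def vector_matrix_mult_def vec_eq_iff mult.commute)
  have "closed ?K"
    unfolding trace_def
    by (intro closed_Int closed_extended_states closed_Collect_all closed_Collect_eq continuous_intros)
  moreover have "convex ?K"
    by (rule convex_Int[OF convex_extended_states])
      (auto simp: convex_def trace_add trace_scaleR simp flip: of_real_add ring_distribs)
  \<comment> \<open>Nonemptiness: one pure state, distributed over the environment with weights
    \<open>p\<close>.\<close>
  moreover have "(\<chi> w. p $ w *\<^sub>R proj v) \<in> ?K"
    using p' psd_proj[of v] v by (auto simp: extended_state_iff ext_nonneg_iff psd_iff qform_scaleR
      ext_trace_def trace_scaleR trace_proj simp flip: of_real_sum)
  then have "?K \<noteq> {}" by blast
  moreover have "ext_map P L R \<in> ?K" if R: "R \<in> ?K" for R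
  proof -
    have "trace (ext_map P L R $ w) = of_real (\<Sum>v\<in>UNIV. P $ v $ w * p $ v)" for w
      using R by (simp add: ext_map_def trace_sum trace_scaleR trace_L)
    then show ?thesis
      using R p' by (simp add: extended_state_ext_map)
  qed
  ultimately obtain R where "R \<in> ?K" "extended_steady_state P L R"
    using steady_state_in[of ?K] by blast
  then show ?thesis using that by blast
qed

lemma steady_state_exists: "\<exists>R. extended_steady_state P L R"
proof -
  define v :: "complex ^ 'n" where "v = axis undefined 1"
  define R :: "complex ^ 'n ^ 'n ^ 'w" where "R = (\<chi> w. (1 / real CARD('w)) *\<^sub>R proj v)"
  have "extended_state R"
    using psd_proj[of v] unfolding R_def
    by (auto simp: extended_state_iff ext_nonneg_iff psd_iff qform_scaleR ext_trace_def trace_scaleR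
        trace_proj v_def norm_axis_1)
  then have "{R :: complex ^ 'n ^ 'n ^ 'w. extended_state R} \<noteq> {}" by blast
  from steady_state_in[OF closed_extended_states convex_extended_states this]
  show ?thesis using extended_state_ext_map by blast
qed

text \<open>The channels preserve traces, so taking traces in the fixed point equation leaves the
  invariance equation of \<open>P\<close>.\<close>

lemma steady_state_traces_invariant:
  assumes "extended_steady_state P L R"
  shows "invariant_prob_vector P (\<chi> w. Re (trace (R $ w)))"
proof -
  have R: "ext_nonneg R" "ext_trace R = 1" "ext_map P L R = R"
    using assms by (auto simp: extended_steady_state_def extended_state_iff)
  have "(\<Sum>v\<in>UNIV. P $ v $ w * Re (trace (R $ v))) = Re (trace (R $ w))" for w
  proof -
    have "trace (R $ w) = trace (ext_map P L R $ w)" using R by simp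
    also have "\<dots> = (\<Sum>v\<in>UNIV. of_real (P $ v $ w) * trace (R $ v))"
      by (simp add: ext_map_def trace_sum trace_scaleR trace_L)
    finally show ?thesis by simp
  qed
  moreover have "(\<Sum>w\<in>UNIV. Re (trace (R $ w))) = 1"
    using R(2) by (simp add: ext_trace_def flip: Re_sum)
  ultimately show ?thesis
    using R(1) by (simp add: invariant_prob_vector_def prob_vector_def vector_matrix_mult_def
        vec_eq_iff ext_nonneg_def psd_trace_nonneg mult.commute)
qed

end

text \<open>\<open>Rp\<close> is a parameter here: its existence is
  \<open>steady_state_exists\<close> of the weaker locale, its uniqueness is proved inside this
  one.\<close>

locale irreducible_channels = environment_channels P L
  for P :: "real ^ 'w ^ 'w" and L :: "'w \<Rightarrow> complex ^ 'n ^ 'n \<Rightarrow> complex ^ 'n ^ 'n" +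
  fixes Rp :: "complex ^ 'n ^ 'n ^ 'w"
  assumes irred: "irreducible_map (ext_map P L)" and steady: "extended_steady_state P L Rp"
begin

lemma Rp: "ext_nonneg Rp" "ext_trace Rp = 1" "ext_map P L Rp = Rp"
  using steady by (auto simp: extended_steady_state_def extended_state_iff)

lemma faithful_Rp: "faithful Rp"
proof (rule faithful_fixed[OF irred Rp(1) _ Rp(3)])
  show "Rp \<noteq> 0" using Rp(2) by (auto simp: linear_0[OF linear_ext_trace])
qed

text \<open>A nonzero \<open>H\<close> would make \<open>Rp + s H\<close> hit the boundary of the cone at a fixed point,
  but nonzero fixed points in the cone are faithful, hence interior.\<close>

lemma traceless_fixed_zero:
  assumes H: "\<And>w v. Im (qform v (H $ w)) = 0" "ext_trace H = 0" "ext_map P L H = H"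
  shows "H = 0"
proof (rule ccontr)
  assume "H \<noteq> 0"
  then obtain w i j where h: "H $ w $ i $ j \<noteq> 0"
    by (auto simp: vec_eq_iff)
  define S where "S = {s. ext_nonneg (Rp + s *\<^sub>R H)}"
  have tr: "ext_trace (Rp + s *\<^sub>R H) = 1" for s
    using Rp H by (simp add: ext_trace_add ext_trace_scaleR)
  have fixed: "ext_map P L (Rp + s *\<^sub>R H) = Rp + s *\<^sub>R H" for s
    using Rp H by (simp add: linear_add[OF linear_ext_map] linear_scale[OF linear_ext_map])
  have "closed S"
    using continuous_closed_vimage[OF closed_ext_nonneg, of "\<lambda>s. Rp + s *\<^sub>R H"]
    by (simp add: S_def vimage_def)
  \<comment> \<open>The whole line has trace one, so its points in the cone have entries of norm at
    most 2, whereas a nonzero entry of \<open>H\<close> is scaled by s.\<close>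
  moreover have "bounded S"
  proof (rule boundedI)
    fix s assume "s \<in> S"
    then have "norm ((Rp + s *\<^sub>R H) $ w $ i $ j) \<le> 2"
      using norm_ext_nonneg_le(1)[of "Rp + s *\<^sub>R H" w i j] by (simp add: S_def tr)
    then have "norm (s *\<^sub>R H $ w $ i $ j) \<le> 2 + norm (Rp $ w $ i $ j)"
      using norm_diff_ineq[of "s *\<^sub>R H $ w $ i $ j" "Rp $ w $ i $ j"] by (simp add: add.commute)
    then show "norm s \<le> (2 + norm (Rp $ w $ i $ j)) / norm (H $ w $ i $ j)"
      using h by (simp add: field_simps)
  qed
  moreover have "0 \<in> S"
    using Rp by (simp add: S_def)
  ultimately obtain s where s: "s \<in> S" and max: "\<And>t. t \<in> S \<Longrightarrow> t \<le> s"
    using compact_attains_sup[of S] by (metis compact_eq_bounded_closed empty_iff)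
  have "faithful (Rp + s *\<^sub>R H)"
  proof (rule faithful_fixed[OF irred _ _ fixed])
    show "ext_nonneg (Rp + s *\<^sub>R H)" using s by (simp add: S_def)
    show "Rp + s *\<^sub>R H \<noteq> 0" using tr[of s] by (auto simp: linear_0[OF linear_ext_trace])
  qed
  then obtain e where e: "e > 0" "ext_nonneg (Rp + s *\<^sub>R H + e *\<^sub>R H)"
    using faithful_perturb[of _ H] H by blast
  then have "s + e \<in> S"
    by (simp add: S_def algebra_simps)
  then show False
    using max e(1) by force
qed

text \<open>The trace of \<open>H\<close> is real because diagonal entries are values of the form;
  subtracting that multiple of \<open>Rp\<close> reduces to the traceless case.\<close>

lemma real_form_fixed:
  assumes H: "\<And>w v. Im (qform v (H $ w)) = 0" "ext_map P L H = H"
  shows "H = Re (ext_trace H) *\<^sub>R Rp"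
proof -
  have "Im (H $ w $ i $ i) = 0" for w i
    using H(1) by (metis qform_axis)
  then have "Im (ext_trace H) = 0"
    by (simp add: ext_trace_def trace_def)
  then have tr: "ext_trace H = of_real (Re (ext_trace H))"
    by (simp add: complex_eq_iff)
  have "H - Re (ext_trace H) *\<^sub>R Rp = 0"
  proof (rule traceless_fixed_zero)
    show "Im (qform v ((H - Re (ext_trace H) *\<^sub>R Rp) $ w)) = 0" for w v
      using H Rp by (simp add: qform_diff qform_scaleR ext_nonneg_iff)
    show "ext_trace (H - Re (ext_trace H) *\<^sub>R Rp) = 0"
      using Rp tr by (simp add: ext_trace_diff ext_trace_scaleR scaleR_conv_of_real[where 'a=complex])
    show "ext_map P L (H - Re (ext_trace H) *\<^sub>R Rp) = H - Re (ext_trace H) *\<^sub>R Rp"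
      using H Rp by (simp add: linear_diff[OF linear_ext_map] linear_scale[OF linear_ext_map])
  qed
  then show ?thesis by simp
qed

lemma steady_state_unique: "extended_steady_state P L R \<Longrightarrow> R = Rp"
  using real_form_fixed[of R] by (auto simp: extended_steady_state_def extended_state_iff ext_nonneg_iff)

text \<open>\<open>H\<close> and \<open>K\<close> are the self-adjoint parts of R = H + \<i> K. The
  images of \<open>H\<close> and \<open>K\<close> again have real forms, so comparing real and
  imaginary parts of the form of R shows that both are fixed.\<close>

lemma fixed_points:
  assumes R: "ext_map P L R = R"
  shows "\<exists>c. R = ext_cmul c Rp"
proof -
  define H where "H = (\<chi> w. (1 / 2) *\<^sub>R (R $ w + cadjoint (R $ w)))"
  define K where "K = (\<chi> w. map_matrix ((*) (- \<i> / 2)) (R $ w - cadjoint (R $ w)))"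
  have qH: "qform v (H $ w) = of_real (Re (qform v (R $ w)))" for v w
    by (simp add: H_def qform_scaleR qform_add qform_adjoint complex_eq_iff)
  have qK: "qform v (K $ w) = of_real (Im (qform v (R $ w)))" for v w
    unfolding K_def by (simp only: vec_lambda_beta qform_cmul qform_diff qform_adjoint) (simp add: complex_eq_iff)
  have qR: "qform v ((H' + ext_cmul \<i> K') $ w) = qform v (H' $ w) + \<i> * qform v (K' $ w)" for v w H' K'
    by (simp add: qform_add ext_cmul_def qform_cmul)
  have RHK: "R = H + ext_cmul \<i> K"
    unfolding vec_eq_iff[of R]
    by (intro allI qform_eqI) (simp only: qR qH qK, simp add: complex_eq_iff)
  have "ext_map P L H + ext_cmul \<i> (ext_map P L K) = R"
    using R unfolding RHK by (simp add: linear_add[OF linear_ext_map] ext_map_cmul)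
  then have *: "qform v (ext_map P L H $ w) + \<i> * qform v (ext_map P L K $ w) = qform v (R $ w)" for v w
    using qR by metis
  have im: "Im (qform v (ext_map P L H $ w)) = 0" "Im (qform v (ext_map P L K $ w)) = 0" for v w
    by (rule ext_map_real_form, simp add: qH qK)+
  have "ext_map P L H = H" "ext_map P L K = K"
    unfolding vec_eq_iff[of "ext_map P L _"]
    by (intro allI qform_eqI; use *[symmetric] im in \<open>simp add: qH qK complex_eq_iff\<close>)+
  then have "H = Re (ext_trace H) *\<^sub>R Rp" "K = Re (ext_trace K) *\<^sub>R Rp"
    using qH qK by (auto intro!: real_form_fixed)
  then have "R = ext_cmul (Complex (Re (ext_trace H)) (Re (ext_trace K))) Rp"
    using RHK by (auto simp: vec_eq_iff ext_cmul_def complex_eq_iff)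
  then show ?thesis ..
qed

end

subsection \<open>Poisson equation and convergence to the steady state\<close>

context environment_channels
begin

text \<open>The dual of \<open>ext_map P L\<close>, written as a one-step conditional expectation:
  \<open>X\<close> is averaged over the successors of \<open>w\<close> before the dual channel at
  \<open>w\<close> is applied.\<close>

definition ext_dual :: "complex ^ 'n ^ 'n ^ 'w \<Rightarrow> complex ^ 'n ^ 'n ^ 'w" where
  "ext_dual X = (\<chi> w. dual_map (L w) (\<Sum>u\<in>UNIV. P $ w $ u *\<^sub>R X $ u))"

lemma hs_pairing_ext_dual:
  "hs_pairing \<alpha> (ext_dual X $ w) = (\<Sum>u\<in>UNIV. of_real (P $ w $ u) * hs_pairing (L w \<alpha>) (X $ u))"
  by (simp add: ext_dual_def dual_map[OF clinear_L] linear_sum[OF linear_hs_pairing_right]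
      hs_pairing_scaleR_right)

lemma ext_pairing_ext_dual: "ext_pairing (ext_map P L R) X = ext_pairing R (ext_dual X)"
  unfolding ext_pairing_def hs_pairing_ext_dual
  by (subst sum.swap) (simp add: ext_map_def linear_sum[OF linear_hs_pairing_left] hs_pairing_scaleR_left)

lemma inner_ext_map: "inner (ext_map P L R) X = inner R (ext_dual X)"
  by (simp add: ext_pairing_ext_dual flip: Re_ext_pairing)

text \<open>Linearity is inherited from being the adjoint of a linear map, which avoids unfolding
  the definite description in \<open>dual_map\<close>.\<close>

lemma linear_ext_dual: "linear ext_dual"
proof -
  have "adjoint (ext_map P L) = ext_dual"
    by (rule adjoint_unique) (simp add: inner_ext_map)
  then show ?thesis
    using adjoint_linear[OF linear_ext_map] by simp
qed

end

context irreducible_channels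
begin

text \<open>The range of \<open>id - ext_dual\<close> is the orthogonal complement of the fixed points of its adjoint.\<close>

lemma poisson_equation: "\<exists>Y. X = (\<chi> w. mat (ext_pairing Rp X)) + Y - ext_dual Y"
proof -
  define c where "c = ext_pairing Rp X"
  define Z where "Z = X - (\<chi> w. mat c)"
  define T where "T = (\<lambda>Y. Y - ext_dual Y)"
  have "linear T"
    unfolding T_def by (intro linear_compose_sub linear_ident linear_ext_dual)
  then have "subspace (range T)"
    by (simp add: linear_subspace_image)
  then obtain y u where y: "y \<in> range T" and u: "\<And>x. x \<in> range T \<Longrightarrow> orthogonal u x" and Z: "Z = y + u"
    using orthogonal_subspace_decomp_exists[of "range T" Z] span_eq_iff[of "range T"] by metis
  \<comment> \<open>\<open>u\<close> is orthogonal to the range of \<open>T\<close>, so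
    \<open>u - ext_map P L u\<close> is orthogonal to everything, in particular to itself.\<close>
  have "ext_map P L u = u"
  proof -
    have "inner (u - ext_map P L u) x = inner u (T x)" for x
      by (simp add: T_def inner_diff_left inner_diff_right inner_ext_map)
    then have "inner (u - ext_map P L u) (u - ext_map P L u) = 0"
      using u by (simp add: orthogonal_def)
    then show ?thesis by simp
  qed
  then obtain k where k: "u = ext_cmul k Rp"
    using fixed_points by blast
  \<comment> \<open>The constant c is chosen so that \<open>Z\<close> has zero complex pairing with
    \<open>Rp\<close>, hence is orthogonal to every complex multiple of it, such as
    \<open>u\<close>. With u orthogonal to y = Z - u this leaves |u|^2 = 0.\<close>
  have "ext_pairing Rp Z = 0"
    using Rp by (simp add: Z_def linear_diff[OF linear_ext_pairing_right] ext_pairing_mat c_def)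
  then have "inner u Z = 0"
    by (simp add: k ext_pairing_cmul_left flip: Re_ext_pairing)
  moreover have "inner u y = 0"
    using u[OF y] by (simp add: orthogonal_def)
  ultimately have "u = 0"
    by (simp add: Z inner_add_right)
  then obtain Y where "Z = T Y"
    using y Z by auto
  then have "X = (\<chi> w. mat c) + Y - ext_dual Y"
    by (simp add: Z_def T_def algebra_simps)
  then show ?thesis
    unfolding c_def ..
qed

text \<open>Doeblin minorization, uniform by compactness of the set of states.\<close>

lemma doeblin:
  assumes "positivity_improving (ext_map P L ^^ m)"
  obtains e where "0 < e" "e < 1"
    "\<And>R. extended_state R \<Longrightarrow> \<exists>S. extended_state S \<and> (ext_map P L ^^ m) R = e *\<^sub>R Rp + (1 - e) *\<^sub>R S"
proof -
  define K where "K = (ext_map P L ^^ m) ` {R. extended_state R}"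
  have "compact K"
    unfolding K_def by (intro compact_continuous_image compact_extended_states linear_continuous_on
        linear_conv_bounded_linear[THEN iffD1] linear_funpow)
  moreover have "faithful R" if R: "R \<in> K" for R
  proof -
    obtain S where S: "extended_state S" "R = (ext_map P L ^^ m) S"
      using R by (auto simp: K_def)
    moreover have "S \<noteq> 0"
      using S(1) by (auto simp: extended_state_iff linear_0[OF linear_ext_trace])
    ultimately show ?thesis
      using assms by (simp add: positivity_improving_def extended_state_iff)
  qed
  ultimately obtain d where d: "d > 0" "\<And>R w v. R \<in> K \<Longrightarrow> d * (norm v)\<^sup>2 \<le> Re (qform v (R $ w))"
    using faithful_compact_bound[of K] by metis
  obtain M where M: "M > 0" "\<And>w v. \<bar>Re (qform v (Rp $ w))\<bar> \<le> M * (norm v)\<^sup>2"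
    using qform_bound by blast
  \<comment> \<open>With e M <= d the form of \<open>e *\<^sub>R Rp\<close> stays below that of
    every element of \<open>K\<close>; the cap 1/2 allows the remainder to be normalized by 1 -
    e.\<close>
  define e where "e = min (1 / 2) (d / M)"
  have e: "0 < e" "e < 1" "e * M \<le> d"
    using d M by (auto simp: e_def min_def field_simps)
  show ?thesis
  proof (rule that[OF e(1,2)])
    fix R :: "complex ^ 'n ^ 'n ^ 'w" assume R: "extended_state R"
    define Q where "Q = (ext_map P L ^^ m) R"
    have Q: "extended_state Q" "Q \<in> K"
      using R by (auto simp: Q_def K_def extended_state_funpow)
    define S where "S = (1 / (1 - e)) *\<^sub>R (Q - e *\<^sub>R Rp)"
    have "e * Re (qform v (Rp $ w)) \<le> Re (qform v (Q $ w))" for v w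
    proof -
      have "e * Re (qform v (Rp $ w)) \<le> e * (M * (norm v)\<^sup>2)"
        using M(2)[of v w] e by (intro mult_left_mono) auto
      also have "\<dots> \<le> d * (norm v)\<^sup>2"
        using mult_right_mono[OF e(3), of "(norm v)\<^sup>2"] by (simp add: mult.assoc)
      also have "\<dots> \<le> Re (qform v (Q $ w))"
        by (rule d(2)[OF Q(2)])
      finally show ?thesis .
    qed
    then have "ext_nonneg S"
      using Q Rp(1) e by (simp add: S_def ext_nonneg_iff extended_state_iff qform_diff qform_scaleR)
    moreover have "ext_trace (Q - e *\<^sub>R Rp) = (1 - e) *\<^sub>R 1"
      using Q Rp(2) by (simp add: ext_trace_diff ext_trace_scaleR extended_state_iff scaleR_diff_left)
    then have "ext_trace S = 1"
      using e by (simp add: S_def ext_trace_scaleR)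
    moreover have "Q = e *\<^sub>R Rp + (1 - e) *\<^sub>R S"
      using e by (simp add: S_def)
    ultimately show "\<exists>S. extended_state S \<and> (ext_map P L ^^ m) R = e *\<^sub>R Rp + (1 - e) *\<^sub>R S"
      unfolding Q_def extended_state_iff by blast
  qed
qed

text \<open>\<open>Rp\<close> is fixed, so splitting off its share e in each block of
  \<open>Suc m\<close> steps shrinks the difference to \<open>Rp\<close> by the factor 1 -
  e.\<close>

lemma primitive_tendsto:
  assumes prim: "primitive_map (ext_map P L)" and R: "extended_state R"
  shows "(\<lambda>n. (ext_map P L ^^ n) R) \<longlonglongrightarrow> Rp"
proof -
  let ?F = "ext_map P L"
  obtain m where m: "positivity_improving (?F ^^ m)"
    using prim by (auto simp: primitive_map_def)
  \<comment> \<open>The exponent m may be 0, and block lengths must be positive. One more step is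
    harmless: trace preservation keeps nonzero elements of the cone nonzero.\<close>
  have "positivity_improving (?F ^^ Suc m)"
    unfolding positivity_improving_def
  proof (intro allI impI)
    fix Y :: "complex ^ 'n ^ 'n ^ 'w" assume Y: "ext_nonneg Y \<and> Y \<noteq> 0"
    then have "ext_nonneg (?F Y)" "?F Y \<noteq> 0"
      using ext_nonneg_zero[of Y] ext_trace_ext_map[of Y]
      by (auto simp: ext_map_nonneg linear_0[OF linear_ext_trace])
    then show "faithful ((?F ^^ Suc m) Y)"
      using m by (simp add: positivity_improving_def funpow_swap1)
  qed
  then obtain e where e: "0 < e" "e < 1" and
    step: "\<And>R. extended_state R \<Longrightarrow> \<exists>S. extended_state S \<and> (?F ^^ Suc m) R = e *\<^sub>R Rp + (1 - e) *\<^sub>R S"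
    by (rule doeblin) blast
  have iter: "\<exists>S. extended_state S \<and> (?F ^^ (Suc m * k)) R - Rp = (1 - e) ^ k *\<^sub>R (S - Rp)"
    if "extended_state R" for R k
    using that
  proof (induction k arbitrary: R)
    case (Suc k)
    obtain S where S: "extended_state S" "(?F ^^ Suc m) R = e *\<^sub>R Rp + (1 - e) *\<^sub>R S"
      using step[OF Suc.prems] by blast
    obtain S' where S': "extended_state S'" "(?F ^^ (Suc m * k)) S - Rp = (1 - e) ^ k *\<^sub>R (S' - Rp)"
      using Suc.IH[OF S(1)] by blast
    have fixed: "(?F ^^ n) Rp = Rp" for n
      using Rp(3) by (induction n) auto
    have "(?F ^^ (Suc m * Suc k)) R = (?F ^^ (Suc m * k)) ((?F ^^ Suc m) R)"
      by (simp only: mult_Suc_right add.commute[of "Suc m"] funpow_add o_apply)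
    also have "\<dots> = e *\<^sub>R Rp + (1 - e) *\<^sub>R (?F ^^ (Suc m * k)) S"
      unfolding S(2) by (simp only: linear_add[OF linear_funpow] linear_scale[OF linear_funpow] fixed)
    finally have "(?F ^^ (Suc m * Suc k)) R - Rp = (1 - e) *\<^sub>R ((?F ^^ (Suc m * k)) S - Rp)"
      by (simp add: algebra_simps)
    then show ?case
      unfolding S'(2) using S'(1) by auto
  qed auto
  obtain B where B: "\<And>R. extended_state R \<Longrightarrow> norm (R - Rp) \<le> B"
  proof -
    have "bounded ((\<lambda>R. R - Rp) ` {R :: complex ^ 'n ^ 'n ^ 'w. extended_state R})"
      by (intro compact_imp_bounded compact_continuous_image compact_extended_states continuous_intros)
    then show ?thesis
      using that by (auto simp: bounded_iff)
  qed
  \<comment> \<open>The n mod \<open>Suc m\<close> leftover steps are run first and only replace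
    \<open>R\<close> by another state; \<open>B\<close> bounds the distance of all states from
    \<open>Rp\<close>.\<close>
  have bound: "norm ((?F ^^ n) R - Rp) \<le> (1 - e) ^ (n div Suc m) * B" for n
  proof -
    obtain S where S: "extended_state S"
      "(?F ^^ (Suc m * (n div Suc m))) ((?F ^^ (n mod Suc m)) R) - Rp = (1 - e) ^ (n div Suc m) *\<^sub>R (S - Rp)"
      using iter[OF extended_state_funpow[OF R]] by blast
    moreover have "(?F ^^ (Suc m * (n div Suc m))) ((?F ^^ (n mod Suc m)) R) = (?F ^^ n) R"
      unfolding o_apply[symmetric, of "?F ^^ (Suc m * (n div Suc m))"] funpow_add[symmetric] mult_div_mod_eq ..
    ultimately show ?thesis
      using B[OF S(1)] e by (simp add: mult_left_mono)
  qed
  have "(\<lambda>n. (1 - e) ^ (n div Suc m) * B) \<longlonglongrightarrow> 0 * B"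
  proof (intro tendsto_mult tendsto_const)
    have "filterlim (\<lambda>n. n div Suc m) at_top sequentially"
      by (rule filterlim_at_top_div_const_nat) simp
    then show "(\<lambda>n. (1 - e) ^ (n div Suc m)) \<longlonglongrightarrow> 0"
      using e by (rule_tac filterlim_compose[OF LIMSEQ_power_zero]) auto
  qed
  then have lim: "(\<lambda>n. (1 - e) ^ (n div Suc m) * B) \<longlonglongrightarrow> 0"
    by (simp only: mult_zero_left)
  have "(\<lambda>n. (?F ^^ n) R - Rp) \<longlonglongrightarrow> 0"
    by (rule Lim_null_comparison[OF _ lim]) (intro always_eventually allI bound)
  then show ?thesis
    by (rule LIM_zero_cancel)
qed

end

subsection \<open>Markov expectations and a law of large numbers\<close>

text \<open>Between k^2 and (k + 1)^2 at most 2 k further terms of size \<open>B\<close> enter the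
  sum, which changes the mean by at most 2 B / k.\<close>

lemma mean_tendsto_zero_of_squares:
  fixes d :: "nat \<Rightarrow> 'a :: real_normed_vector"
  assumes d: "\<And>n. norm (d n) \<le> B"
    and sq: "(\<lambda>k. norm (\<Sum>n<k\<^sup>2. d n) / real (k\<^sup>2)) \<longlonglongrightarrow> 0"
  shows "ergodic_mean d \<longlonglongrightarrow> 0"
proof -
  define S where "S N = (\<Sum>n<N. d n)" for N
  define g where "g k = norm (S (k\<^sup>2)) / real (k\<^sup>2) + 2 * B * (1 / real k)" for k
  have B: "0 \<le> B" using order_trans[OF norm_ge_zero d] .
  have "g \<longlonglongrightarrow> 0 + 2 * B * 0"
    unfolding g_def S_def by (intro tendsto_intros sq lim_1_over_n)
  moreover have "filterlim floor_sqrt at_top sequentially"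
    unfolding filterlim_at_top
  proof
    fix k
    show "eventually (\<lambda>N. k \<le> floor_sqrt N) sequentially"
      using eventually_ge_at_top[of "k\<^sup>2"] by eventually_elim (metis floor_sqrt_inverse_power2 mono_floor_sqrt')
  qed
  ultimately have lim: "(\<lambda>N. g (floor_sqrt N)) \<longlonglongrightarrow> 0"
    using filterlim_compose by fastforce
  have bd: "norm (ergodic_mean d N) \<le> g (floor_sqrt N)" if N: "0 < N" for N
  proof -
    define k where "k = floor_sqrt N"
    have k: "0 < k" "k\<^sup>2 \<le> N"
      using N by (auto simp: k_def)
    have "N < (Suc k)\<^sup>2"
      using Suc_floor_sqrt_power2_gt by (simp add: k_def)
    then have k2: "N \<le> k\<^sup>2 + 2 * k"
      by (simp add: power2_eq_square)
    have "S N = S (k\<^sup>2) + (\<Sum>n\<in>{k\<^sup>2..<N}. d n)"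
      using k(2) sum.atLeastLessThan_concat[of 0 "k\<^sup>2" N d] by (simp add: S_def atLeast0LessThan)
    also have "norm \<dots> \<le> norm (S (k\<^sup>2)) + real (card {k\<^sup>2..<N}) * B"
      by (intro norm_triangle_mono order_refl sum_norm_bound) (use d in auto)
    also have "real (card {k\<^sup>2..<N}) * B \<le> 2 * real k * B"
      using k2 B by (intro mult_right_mono) auto
    finally have "norm (S N) \<le> norm (S (k\<^sup>2)) + 2 * real k * B" by simp
    then have "norm (S N) / real N \<le> (norm (S (k\<^sup>2)) + 2 * real k * B) / real (k\<^sup>2)"
      using k N B by (intro frac_le) auto
    also have "\<dots> = g k"
      using k by (simp add: g_def add_divide_distrib power2_eq_square)
    finally show ?thesis
      by (simp add: ergodic_mean_def S_def k_def divide_inverse mult.commute)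
  qed
  have "eventually (\<lambda>N. norm (ergodic_mean d N) \<le> g (floor_sqrt N)) sequentially"
    using eventually_gt_at_top[of "0 :: nat"] by (rule eventually_mono) (rule bd)
  then show ?thesis
    using lim by (rule Lim_null_comparison)
qed

text \<open>By orthogonality the second moment of the \<open>N\<close>-th partial sum is \<open>O(N)\<close>, so the means at the
  squares are square summable; boundedness takes care of the times in between.\<close>

lemma (in prob_space) bounded_orthogonal_slln:
  fixes D :: "nat \<Rightarrow> 'a \<Rightarrow> 'b :: euclidean_space"
  assumes [measurable]: "\<And>n. D n \<in> borel_measurable M"
    and bound: "\<And>n w. norm (D n w) \<le> B"
    and orth: "\<And>m n. m < n \<Longrightarrow> expectation (\<lambda>w. inner (D m w) (D n w)) = 0"
  shows "AE w in M. ergodic_mean (\<lambda>n. D n w) \<longlonglongrightarrow> 0"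
proof -
  define S where "S N w = (\<Sum>n<N. D n w)" for N w
  have [measurable]: "S N \<in> borel_measurable M" for N
    unfolding S_def by measurable
  have B: "0 \<le> B" using order_trans[OF norm_ge_zero bound] .
  have int: "integrable M (\<lambda>w. inner (D m w) (D n w))" for m n
  proof (rule integrable_const_bound[where B = "B * B"])
    have "norm (inner (D m w) (D n w)) \<le> B * B" for w
      using order_trans[OF Cauchy_Schwarz_ineq2] mult_mono[OF bound bound B norm_ge_zero] by (metis real_norm_def)
    then show "AE w in M. norm (inner (D m w) (D n w)) \<le> B * B" by simp
  qed measurable
  have moment: "integrable M (\<lambda>w. inner (S N w) (S N w)) \<and> expectation (\<lambda>w. inner (S N w) (S N w)) \<le> real N * B\<^sup>2" for N
  proof (induction N)
    case (Suc N)
    have eq: "inner (S (Suc N) w) (S (Suc N) w)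
        = inner (S N w) (S N w) + 2 * (\<Sum>n<N. inner (D n w) (D N w)) + inner (D N w) (D N w)" for w
    proof -
      have "S (Suc N) w = S N w + D N w" "inner (S N w) (D N w) = (\<Sum>n<N. inner (D n w) (D N w))"
        by (simp_all add: S_def inner_sum_left)
      then show ?thesis
        by (simp add: inner_add_left inner_add_right inner_commute[of "D N w" "S N w"])
    qed
    have "inner (D N w) (D N w) \<le> B\<^sup>2" for w
      using bound by (simp add: power_mono flip: power2_norm_eq_inner)
    then have "expectation (\<lambda>w. inner (D N w) (D N w)) \<le> expectation (\<lambda>w. B\<^sup>2)"
      by (intro integral_mono int) auto
    then show ?case
      unfolding eq using Suc.IH int orth by (auto simp: prob_space algebra_simps)
  qed (simp add: S_def)
  \<comment> \<open>The second moment N B^2 divided by N^2 at N = (k + 1)^2 gives B^2 / (k + 1)^2.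
    Starting at \<open>Suc k\<close> avoids division by zero.\<close>
  define V where "V k w = (norm (S ((Suc k)\<^sup>2) w) / real ((Suc k)\<^sup>2))\<^sup>2" for k w
  have [measurable]: "V k \<in> borel_measurable M" for k
    unfolding V_def by measurable
  have V: "(\<integral>\<^sup>+w. ennreal (V k w) \<partial>M) \<le> ennreal (B\<^sup>2 * inverse (real (Suc k) ^ 2))" for k
  proof -
    define N where "N = (Suc k)\<^sup>2"
    have N: "real N > 0" by (simp add: N_def)
    have V_eq: "V k w = inner (S N w) (S N w) / (real N)\<^sup>2" for w
      by (simp add: V_def N_def power_divide power2_norm_eq_inner)
    have "(\<integral>\<^sup>+w. ennreal (V k w) \<partial>M) = ennreal (expectation (V k))"
      using moment[of N] unfolding V_eq by (intro nn_integral_eq_integral) auto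
    also have "expectation (V k) \<le> real N * B\<^sup>2 / (real N)\<^sup>2"
      unfolding V_eq using moment[of N] by (simp add: divide_right_mono)
    also have "\<dots> = B\<^sup>2 * inverse (real N)"
      using N by (simp add: power2_eq_square field_simps)
    finally show ?thesis
      by (simp add: N_def ennreal_leI)
  qed
  have "summable (\<lambda>k. B\<^sup>2 * inverse (real (Suc k) ^ 2))"
    using inverse_power_summable[of 2, where 'a = real] by (intro summable_mult) (subst summable_Suc_iff, simp)
  then have "(\<Sum>k. ennreal (B\<^sup>2 * inverse (real (Suc k) ^ 2))) \<noteq> top"
    by (intro ennreal_suminf_neq_top) auto
  \<comment> \<open>A series with finite expectation converges almost surely, so its terms tend to
    zero.\<close>
  moreover have "(\<integral>\<^sup>+w. (\<Sum>k. ennreal (V k w)) \<partial>M) \<le> (\<Sum>k. ennreal (B\<^sup>2 * inverse (real (Suc k) ^ 2)))"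
    by (subst nn_integral_suminf, measurable) (intro suminf_le V summableI)
  ultimately have "(\<integral>\<^sup>+w. (\<Sum>k. ennreal (V k w)) \<partial>M) \<noteq> \<infinity>"
    by (auto simp: top_unique)
  then have "AE w in M. (\<Sum>k. ennreal (V k w)) \<noteq> \<infinity>"
    by (intro nn_integral_PInf_AE) measurable
  then show ?thesis
  proof eventually_elim
    case (elim w)
    then have "summable (\<lambda>k. V k w)"
      by (intro summable_suminf_not_top) (auto simp: V_def)
    then have "(\<lambda>k. V k w) \<longlonglongrightarrow> 0"
      by (rule summable_LIMSEQ_zero)
    then have "(\<lambda>k. sqrt (V k w)) \<longlonglongrightarrow> sqrt 0"
      by (rule tendsto_real_sqrt)
    then have "(\<lambda>k. norm (S ((Suc k)\<^sup>2) w) / real ((Suc k)\<^sup>2)) \<longlonglongrightarrow> 0"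
      by (simp add: V_def)
    then have "(\<lambda>k. norm (\<Sum>n<k\<^sup>2. D n w) / real (k\<^sup>2)) \<longlonglongrightarrow> 0"
      unfolding S_def by (rule LIMSEQ_imp_Suc)
    then show ?case
      by (rule mean_tendsto_zero_of_squares[OF bound])
  qed
qed

text \<open>Adaptedness to the natural filtration, with coordinate \<open>m\<close> included. Over a
  finite environment it makes integrals finite sums over cylinders.\<close>

definition determined_upto :: "nat \<Rightarrow> ((nat \<Rightarrow> 'w) \<Rightarrow> 'b) \<Rightarrow> bool" where
  "determined_upto m F \<longleftrightarrow> (\<forall>w w'. (\<forall>i\<le>m. w i = w' i) \<longrightarrow> F w = F w')"

text \<open>Exactly one index contributes, namely \<open>restrict w {..m}\<close>; its undefined
  values beyond \<open>m\<close> are invisible to \<open>F\<close>.\<close>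

lemma determined_upto_expand:
  fixes F :: "(nat \<Rightarrow> 'w :: finite) \<Rightarrow> 'b :: real_vector"
  assumes "determined_upto m F"
  shows "F w = (\<Sum>v\<in>PiE {..m} (\<lambda>_. UNIV). indicator {w. \<forall>i\<le>m. w i = v i} w *\<^sub>R F v)"
proof -
  have "indicator {w. \<forall>i\<le>m. w i = v i} w *\<^sub>R F v = (if v = restrict w {..m} then F v else 0)"
    if "v \<in> PiE {..m} (\<lambda>_. UNIV)" for v
  proof -
    have "v = restrict w {..m} \<longleftrightarrow> (\<forall>i\<le>m. w i = v i)"
      using that by (auto simp: fun_eq_iff PiE_iff extensional_def)
    then show ?thesis by (simp add: indicator_def)
  qed
  then have "(\<Sum>v\<in>PiE {..m} (\<lambda>_. UNIV). indicator {w. \<forall>i\<le>m. w i = v i} w *\<^sub>R F v)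
      = (\<Sum>v\<in>PiE {..m} (\<lambda>_. UNIV). if v = restrict w {..m} then F v else 0)"
    by (intro sum.cong refl)
  also have "\<dots> = F (restrict w {..m})"
    by (subst sum.delta) (auto intro!: finite_PiE)
  also have "\<dots> = F w"
    using assms by (simp add: determined_upto_def)
  finally show ?thesis ..
qed

section \<open>Integrals of functions of finitely many coordinates of a Markov chain\<close>

locale markov_chain =
  fixes p :: "real ^ 'w" and P :: "real ^ 'w ^ 'w" and M :: "(nat \<Rightarrow> 'w) measure"
  assumes initial: "prob_vector p" and stochastic: "right_stochastic P"
    and markov: "is_markov_measure p P M"
begin

lemma p_nonneg: "0 \<le> p $ w"
  and p_sum: "(\<Sum>w\<in>UNIV. p $ w) = 1"
  using initial by (auto simp: prob_vector_def)

lemma P_nonneg: "0 \<le> P $ v $ w"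
  and P_sum: "(\<Sum>w\<in>UNIV. P $ v $ w) = 1"
  using stochastic by (auto simp: right_stochastic_def prob_vector_def)

lemma cylinder_measurable: "{w. \<forall>i\<le>n. w i = v i} \<in> sets M"
  using markov cylinder_sets[of n v] by (simp add: is_markov_measure_def)

lemma has_bochner_integral_cylinder:
  "has_bochner_integral M (\<lambda>w. indicator {w. \<forall>i\<le>n. w i = v i} w *\<^sub>R x)
     ((p $ v 0 * (\<Prod>i<n. P $ v i $ v (Suc i))) *\<^sub>R x)"
  for x :: "'b :: {banach, second_countable_topology}"
proof (rule has_bochner_integral_scaleR_left)
  let ?A = "{w. \<forall>i\<le>n. w i = v i}"
  have e: "emeasure M ?A = ennreal (p $ v 0 * (\<Prod>i<n. P $ v i $ v (Suc i)))"
    using markov by (simp add: is_markov_measure_def)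
  then have "measure M ?A = p $ v 0 * (\<Prod>i<n. P $ v i $ v (Suc i))"
    by (simp add: measure_def p_nonneg P_nonneg prod_nonneg)
  then show "has_bochner_integral M (indicator ?A) (p $ v 0 * (\<Prod>i<n. P $ v i $ v (Suc i)))"
    using has_bochner_integral_real_indicator[OF cylinder_measurable[of n v]] e by simp
qed

lemma has_bochner_integral_determined:
  fixes F :: "(nat \<Rightarrow> 'w) \<Rightarrow> 'b :: {banach, second_countable_topology}"
  assumes "determined_upto m F"
  shows "has_bochner_integral M F
    (\<Sum>v\<in>PiE {..m} (\<lambda>_. UNIV). (p $ v 0 * (\<Prod>i<m. P $ v i $ v (Suc i))) *\<^sub>R F v)"
  by (rule has_bochner_integral_cong[THEN iffD2, OF refl determined_upto_expand[OF assms] refl])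
    (intro has_bochner_integral_sum has_bochner_integral_cylinder)

lemma integrable_determined:
  fixes F :: "(nat \<Rightarrow> 'w) \<Rightarrow> 'b :: {banach, second_countable_topology}"
  shows "determined_upto m F \<Longrightarrow> integrable M F"
  using has_bochner_integral_determined by (blast intro: integrable.intros)

lemma integral_determined_0:
  fixes F :: "(nat \<Rightarrow> 'w) \<Rightarrow> 'b :: {banach, second_countable_topology}"
  assumes F: "determined_upto 0 F"
  shows "(LINT w|M. F w) = (\<Sum>x\<in>UNIV. p $ x *\<^sub>R F (\<lambda>_. x))"
proof (rule has_bochner_integral_integral_eq)
  have "F w = (\<Sum>x\<in>UNIV. indicator {w. \<forall>i\<le>0. w i = x} w *\<^sub>R F (\<lambda>_. x))" for w
  proof -
    have "indicator {w. \<forall>i\<le>0. w i = x} w *\<^sub>R F (\<lambda>_. x) = (if x = w 0 then F (\<lambda>_. x) else 0)" for x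
      by (auto simp: indicator_def)
    then have "(\<Sum>x\<in>UNIV. indicator {w. \<forall>i\<le>0. w i = x} w *\<^sub>R F (\<lambda>_. x)) = F (\<lambda>_. w 0)"
      by (simp only: sum.delta finite UNIV_I if_True)
    then show ?thesis
      using F[unfolded determined_upto_def, rule_format, of "\<lambda>_. w 0" w] by simp
  qed
  then show "has_bochner_integral M F (\<Sum>x\<in>UNIV. p $ x *\<^sub>R F (\<lambda>_. x))"
  proof (rule has_bochner_integral_cong[THEN iffD2, OF refl _ refl])
    show "has_bochner_integral M (\<lambda>w. \<Sum>x\<in>UNIV. indicator {w. \<forall>i\<le>0. w i = x} w *\<^sub>R F (\<lambda>_. x))
        (\<Sum>x\<in>UNIV. p $ x *\<^sub>R F (\<lambda>_. x))"
      using has_bochner_integral_cylinder[of 0 "\<lambda>_. x" for x] by (intro has_bochner_integral_sum) auto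
  qed
qed

text \<open>Tower property: the coordinate \<open>Suc m\<close> is integrated out with the
  transition row of \<open>w m\<close>. In the cylinder expansions the last transition factor moves
  from the weight of the cylinder to the integrand.\<close>

lemma integral_determined_Suc:
  fixes F :: "(nat \<Rightarrow> 'w) \<Rightarrow> 'b :: {banach, second_countable_topology}"
  assumes F: "determined_upto (Suc m) F"
  shows "(LINT w|M. F w) = (LINT w|M. (\<Sum>u\<in>UNIV. P $ w m $ u *\<^sub>R F (w(Suc m := u))))"
proof -
  let ?I = "PiE {..Suc m} (\<lambda>_. UNIV) :: (nat \<Rightarrow> 'w) set"
  let ?C = "\<lambda>n v. {w :: nat \<Rightarrow> 'w. \<forall>i\<le>n. w i = v i}"
  have "(\<Sum>u\<in>UNIV. P $ w m $ u *\<^sub>R F (w(Suc m := u)))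
      = (\<Sum>v\<in>?I. indicator (?C m v) w *\<^sub>R (P $ v m $ v (Suc m) *\<^sub>R F v))" for w
  proof -
    have ind: "indicator (?C (Suc m) v) (w(Suc m := u)) = (indicator (?C m v) w * (if u = v (Suc m) then 1 else 0) :: real)"
      for u v
      by (auto simp: indicator_def le_Suc_eq)
    have "(\<Sum>u\<in>UNIV. P $ w m $ u *\<^sub>R F (w(Suc m := u)))
        = (\<Sum>v\<in>?I. \<Sum>u\<in>UNIV. (P $ w m $ u * (indicator (?C m v) w * (if u = v (Suc m) then 1 else 0))) *\<^sub>R F v)"
      unfolding determined_upto_expand[OF F, of "w(Suc m := u)" for u] ind
      by (subst sum.swap) (simp add: scaleR_sum_right)
    also have "\<dots> = (\<Sum>v\<in>?I. (P $ w m $ v (Suc m) * indicator (?C m v) w) *\<^sub>R F v)"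
    proof (intro sum.cong refl)
      fix v
      have "(\<Sum>u\<in>UNIV. (P $ w m $ u * (indicator (?C m v) w * (if u = v (Suc m) then 1 else 0))) *\<^sub>R F v)
        = (\<Sum>u\<in>UNIV. if u = v (Suc m) then (P $ w m $ u * indicator (?C m v) w) *\<^sub>R F v else 0)"
        by (intro sum.cong refl) auto
      then show "(\<Sum>u\<in>UNIV. (P $ w m $ u * (indicator (?C m v) w * (if u = v (Suc m) then 1 else 0))) *\<^sub>R F v)
        = (P $ w m $ v (Suc m) * indicator (?C m v) w) *\<^sub>R F v"
        by simp
    qed
    also have "\<dots> = (\<Sum>v\<in>?I. indicator (?C m v) w *\<^sub>R (P $ v m $ v (Suc m) *\<^sub>R F v))"
      by (intro sum.cong refl) (auto simp: indicator_def)
    finally show ?thesis .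
  qed
  then have "has_bochner_integral M (\<lambda>w. \<Sum>u\<in>UNIV. P $ w m $ u *\<^sub>R F (w(Suc m := u)))
      (\<Sum>v\<in>?I. (p $ v 0 * (\<Prod>i<m. P $ v i $ v (Suc i))) *\<^sub>R (P $ v m $ v (Suc m) *\<^sub>R F v))"
    by (simp only:) (intro has_bochner_integral_sum has_bochner_integral_cylinder)
  then show ?thesis
    using has_bochner_integral_determined[OF F]
    by (simp add: has_bochner_integral_integral_eq mult.assoc)
qed

sublocale prob_space M
proof
  have "emeasure M (space M) = ennreal (measure M (space M))"
  proof (rule emeasure_eq_ennreal_measure)
    have "integrable M (\<lambda>w. 1 :: real)"
      by (rule integrable_determined[of 0]) (simp add: determined_upto_def)
    then show "emeasure M (space M) \<noteq> top"
      by (auto simp: integrable_iff_bounded)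
  qed
  moreover have "measure M (space M) = 1"
    using integral_determined_0[of "\<lambda>_. 1 :: real"] by (simp add: determined_upto_def p_sum)
  ultimately show "emeasure M (space M) = 1"
    by (simp only: ennreal_1)
qed

end

subsection \<open>Ergodic theorems for trajectories\<close>

lemma determined_upto_mono: "determined_upto m F \<Longrightarrow> m \<le> n \<Longrightarrow> determined_upto n F"
  by (auto simp: determined_upto_def)

lemma rho_traj_cong: "(\<And>i. i \<le> n \<Longrightarrow> w i = w' i) \<Longrightarrow> rho_traj L \<rho> w n = rho_traj L \<rho> w' n"
  by (induction n) auto

lemma rho_traj_fun_upd: "n < m \<Longrightarrow> rho_traj L \<rho> (w(m := u)) n = rho_traj L \<rho> w n"
  by (intro rho_traj_cong) auto

text \<open>The dual maps are moved to the state one at a time. The initial family is constant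
  because coordinate 0 does not enter the Heisenberg product.\<close>

lemma hs_pairing_heisenberg:
  assumes "\<And>w. clinear_map (L w)"
  shows "hs_pairing \<sigma> (heisenberg L w n A) = hs_pairing (rho_traj L (\<lambda>_. \<sigma>) w n) A"
  by (induction n arbitrary: A) (auto simp: dual_map[OF assms])

lemma heisenberg_cong: "(\<And>i. i \<le> n \<Longrightarrow> w i = w' i) \<Longrightarrow> heisenberg L w n A = heisenberg L w' n A"
  by (induction n arbitrary: A) auto

lemma determined_upto_ergodic_mean:
  assumes "\<And>n. determined_upto (Suc n) (\<lambda>w. f w n)"
  shows "determined_upto N (\<lambda>w. ergodic_mean (f w) N)"
  unfolding determined_upto_def
proof (intro allI impI)
  fix w w' :: "nat \<Rightarrow> 'a" assume w: "\<forall>i\<le>N. w i = w' i"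
  \<comment> \<open>The last term of the mean has n = N - 1 and sees coordinates up to N
    exactly.\<close>
  have "f w n = f w' n" if "n < N" for n
    using assms[of n] w that by (auto simp: determined_upto_def)
  then show "ergodic_mean (f w) N = ergodic_mean (f w') N"
    by (simp add: ergodic_mean_def)
qed

lemma norm_ergodic_mean_le:
  assumes "\<And>n. norm (f n) \<le> B"
  shows "norm (ergodic_mean f N) \<le> B"
proof (cases "N = 0")
  \<comment> \<open>The mean over no terms is 0, and \<open>B\<close> is nonnegative because it
    bounds a norm.\<close>
  case True
  then show ?thesis
    using order_trans[OF norm_ge_zero assms] by (simp add: ergodic_mean_def)
next
  case False
  have "norm (\<Sum>n<N. f n) \<le> real (card {..<N}) * B"
    by (rule sum_norm_bound) (rule assms)
  then show ?thesis
    using False by (simp add: ergodic_mean_def field_simps)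
qed

lemma ergodic_mean_linear:
  assumes "linear g"
  shows "ergodic_mean (\<lambda>n. g (f n)) N = g (ergodic_mean f N)"
  by (simp add: ergodic_mean_def linear_scale[OF assms] linear_sum[OF assms])

lemma op_norm_le: "op_norm A \<le> (\<Sum>i\<in>UNIV. \<Sum>j\<in>UNIV. norm (A $ i $ j))"
  unfolding op_norm_def
proof (rule onorm_le)
  fix v
  have "norm (A *v v) \<le> (\<Sum>i\<in>UNIV. norm ((A *v v) $ i))"
    by (rule norm_vec_le_sum)
  also have "\<dots> \<le> (\<Sum>i\<in>UNIV. \<Sum>j\<in>UNIV. norm (A $ i $ j) * norm v)"
    unfolding matrix_vector_mult_def vec_lambda_beta
    by (intro sum_mono order_trans[OF norm_sum])
      (simp add: norm_mult mult_left_mono Finite_Cartesian_Product.norm_nth_le)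
  finally show "norm (A *v v) \<le> (\<Sum>i\<in>UNIV. \<Sum>j\<in>UNIV. norm (A $ i $ j)) * norm v"
    by (simp add: sum_distrib_right)
qed

lemma op_norm_nonneg: "0 \<le> op_norm A"
  unfolding op_norm_def by (intro onorm_pos_le linear_conv_bounded_linear[THEN iffD1]) simp

lemma (in prob_space) L1_convergence_of_bounded:
  fixes f :: "nat \<Rightarrow> 'a \<Rightarrow> complex"
  assumes meas: "\<And>N. f N \<in> borel_measurable M" and bound: "\<And>N w. norm (f N w) \<le> B"
    and lim: "AE w in M. (\<lambda>N. f N w) \<longlonglongrightarrow> c"
  shows "(\<lambda>N. LINT w|M. norm (f N w - c)) \<longlonglongrightarrow> 0"
proof -
  have "(\<lambda>N. LINT w|M. norm (f N w - c)) \<longlonglongrightarrow> (LINT w|M. 0)"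
  proof (rule integral_dominated_convergence[where w = "\<lambda>_. B + norm c"])
    show "AE w in M. (\<lambda>N. norm (f N w - c)) \<longlonglongrightarrow> 0"
      using lim
    proof eventually_elim
      case (elim w)
      then show ?case
        by (intro tendsto_norm_zero) (simp add: LIM_zero)
    qed
    show "AE w in M. norm (norm (f N w - c)) \<le> B + norm c" for N
    proof (rule AE_I2)
      fix w
      show "norm (norm (f N w - c)) \<le> B + norm c"
        using norm_triangle_ineq4[of "f N w" c] bound[of N w] by simp
    qed
  qed (use meas in measurable)
  then show ?thesis by simp
qed

text \<open>The hypothesis \<open>mean\<close> says that \<open>G\<close> has conditional
  expectation zero given the coordinates up to \<open>m\<close>; \<open>F\<close> is unaffected by
  the update at \<open>Suc m\<close> and factors out.\<close>

lemma (in markov_chain) fun_upd_mean_orthogonal: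
  fixes F G :: "(nat \<Rightarrow> 'w) \<Rightarrow> complex"
  assumes F: "determined_upto m F" and G: "determined_upto (Suc m) G"
    and mean: "\<And>w. (\<Sum>u\<in>UNIV. P $ w m $ u *\<^sub>R G (w(Suc m := u))) = 0"
  shows "(LINT w|M. inner (F w) (G w)) = 0"
proof -
  have "determined_upto (Suc m) (\<lambda>w. inner (F w) (G w))"
    using determined_upto_mono[OF F, of "Suc m"] G unfolding determined_upto_def by (metis Suc_n_not_le_n nat_le_linear)
  then have "(LINT w|M. inner (F w) (G w))
      = (LINT w|M. (\<Sum>u\<in>UNIV. P $ w m $ u *\<^sub>R inner (F (w(Suc m := u))) (G (w(Suc m := u)))))"
    by (rule integral_determined_Suc)
  also have "\<dots> = (LINT w|M. inner (F w) (\<Sum>u\<in>UNIV. P $ w m $ u *\<^sub>R G (w(Suc m := u))))"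
  proof (rule Bochner_Integration.integral_cong[OF refl])
    fix w
    have "F (w(Suc m := u)) = F w" for u
      using F[unfolded determined_upto_def, rule_format, of "w(Suc m := u)" w] by simp
    then show "(\<Sum>u\<in>UNIV. P $ w m $ u *\<^sub>R inner (F (w(Suc m := u))) (G (w(Suc m := u))))
        = inner (F w) (\<Sum>u\<in>UNIV. P $ w m $ u *\<^sub>R G (w(Suc m := u)))"
      by (simp add: inner_sum_right)
  qed
  also have "\<dots> = 0"
    by (simp add: mean)
  finally show ?thesis .
qed

section \<open>Trajectories as bounded adapted processes and their expectations\<close>

context environment_channels
begin

lemma determined_upto_pairing:
  "determined_upto (Suc n) (\<lambda>w. hs_pairing (rho_traj L \<rho> w n) (X $ w (Suc n)))"
  unfolding determined_upto_def
proof (intro allI impI)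
  fix w w' :: "nat \<Rightarrow> 'w" assume w: "\<forall>i\<le>Suc n. w i = w' i"
  then have "rho_traj L \<rho> w n = rho_traj L \<rho> w' n"
    by (intro rho_traj_cong) simp
  then show "hs_pairing (rho_traj L \<rho> w n) (X $ w (Suc n)) = hs_pairing (rho_traj L \<rho> w' n) (X $ w' (Suc n))"
    using w by simp
qed

lemma determined_upto_heisenberg:
  "determined_upto (Suc n) (\<lambda>w. heisenberg L w n (X $ w (Suc n)))"
  unfolding determined_upto_def
proof (intro allI impI)
  fix w w' :: "nat \<Rightarrow> 'w" assume w: "\<forall>i\<le>Suc n. w i = w' i"
  then have "heisenberg L w n A = heisenberg L w' n A" for A
    by (intro heisenberg_cong) simp
  then show "heisenberg L w n (X $ w (Suc n)) = heisenberg L w' n (X $ w' (Suc n))"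
    using w by simp
qed

lemma trace_rho_traj: "trace (rho_traj L \<rho> w n) = trace (\<rho> (w 0))"
  by (induction n) (auto simp: trace_L)

lemma psd_rho_traj: "(\<And>w. psd (\<rho> w)) \<Longrightarrow> psd (rho_traj L \<rho> w n)"
  by (induction n) (auto intro: psd_L)

text \<open>The trace is conserved along a trajectory and controls all entries. Positive families of
  any trace are covered, so that \<open>proj v\<close> is a possible start.\<close>

lemma norm_pairing_bounded:
  assumes \<rho>: "\<And>w. psd (\<rho> w)"
  shows "\<exists>B. \<forall>w n u. norm (hs_pairing (rho_traj L \<rho> w n) (X $ u)) \<le> B"
proof -
  define T where "T = (\<Sum>w\<in>UNIV. Re (trace (\<rho> w)))"
  define C where "C u = (\<Sum>i\<in>UNIV. \<Sum>j\<in>UNIV. norm (X $ u $ j $ i))" for u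
  have T: "0 \<le> Re (trace (\<rho> w))" "Re (trace (\<rho> w)) \<le> T" for w
    using member_le_sum[of w UNIV "\<lambda>w. Re (trace (\<rho> w))"] psd_trace_nonneg[OF \<rho>] by (auto simp: T_def)
  have C: "0 \<le> C u" "C u \<le> sum C UNIV" for u
    using member_le_sum[of u UNIV C] by (auto simp: C_def sum_nonneg)
  show ?thesis
  proof (intro exI allI)
    fix w n u
    have "norm (hs_pairing (rho_traj L \<rho> w n) (X $ u)) \<le> 2 * Re (trace (\<rho> (w 0))) * C u"
      using norm_hs_pairing_psd_le[OF psd_rho_traj[OF \<rho>]] by (simp add: trace_rho_traj C_def)
    also have "\<dots> \<le> 2 * T * sum C UNIV"
      using T[of "w 0"] C by (intro mult_mono) (auto intro: order_trans)
    finally show "norm (hs_pairing (rho_traj L \<rho> w n) (X $ u)) \<le> 2 * T * sum C UNIV" .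
  qed
qed

text \<open>Averaging over the first two coordinates leaves the weight p_u P_uv on \<rho> u at the
  site v of coordinate 1; each later step is one application of the extended map.\<close>

lemma expectation_pairing:
  assumes M: "markov_chain p P M"
  shows "(LINT w|M. hs_pairing (rho_traj L \<rho> w n) (X $ w (Suc n)))
    = ext_pairing ((ext_map P L ^^ n) (\<chi> v. \<Sum>u\<in>UNIV. (p $ u * P $ u $ v) *\<^sub>R \<rho> u)) X"
proof -
  interpret M: markov_chain p P M by fact
  show ?thesis
  proof (induction n arbitrary: X)
    case 0
    have "(LINT w|M. hs_pairing (rho_traj L \<rho> w 0) (X $ w (Suc 0)))
        = (LINT w|M. (\<Sum>u\<in>UNIV. P $ w 0 $ u *\<^sub>R hs_pairing (\<rho> (w 0)) (X $ u)))"
      by (subst M.integral_determined_Suc[OF determined_upto_pairing]) simp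
    also have "\<dots> = (\<Sum>x\<in>UNIV. p $ x *\<^sub>R (\<Sum>u\<in>UNIV. P $ x $ u *\<^sub>R hs_pairing (\<rho> x) (X $ u)))"
      by (subst M.integral_determined_0) (auto simp: determined_upto_def)
    also have "\<dots> = ext_pairing (\<chi> v. \<Sum>u\<in>UNIV. (p $ u * P $ u $ v) *\<^sub>R \<rho> u) X"
      unfolding ext_pairing_def vec_lambda_beta scaleR_sum_right
      by (subst sum.swap) (simp add: linear_sum[OF linear_hs_pairing_left] hs_pairing_scaleR_left
          scaleR_conv_of_real[where 'a=complex] mult.assoc)
    finally show ?case by simp
  next
    case (Suc n)
    have "(LINT w|M. hs_pairing (rho_traj L \<rho> w (Suc n)) (X $ w (Suc (Suc n))))
        = (LINT w|M. (\<Sum>u\<in>UNIV. P $ w (Suc n) $ u *\<^sub>R hs_pairing (rho_traj L \<rho> w (Suc n)) (X $ u)))"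
      by (subst M.integral_determined_Suc[OF determined_upto_pairing]) (simp add: rho_traj_fun_upd)
    \<comment> \<open>The average over the last coordinate, with the last channel moved to
      \<open>X\<close>, is an application of \<open>ext_dual\<close>; the induction therefore varies
      \<open>X\<close>.\<close>
    also have "\<dots> = (LINT w|M. hs_pairing (rho_traj L \<rho> w n) (ext_dual X $ w (Suc n)))"
      by (simp add: hs_pairing_ext_dual scaleR_conv_of_real[where 'a=complex])
    finally show ?case
      by (simp add: Suc.IH ext_pairing_ext_dual)
  qed
qed

end

context irreducible_channels
begin

text \<open>Writing \<open>X = c 1 + Y - ext_dual Y\<close>, the sequence is \<open>c\<close> plus a telescoping part plus
  bounded martingale differences.\<close>

theorem pairing_ergodic:
  assumes M: "markov_chain p P M" and \<rho>: "\<And>w. psd (\<rho> w)"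
  shows "AE w in M. ergodic_mean (\<lambda>n. hs_pairing (rho_traj L \<rho> w n) (X $ w (Suc n)))
    \<longlonglongrightarrow> cnj (trace (\<rho> (w 0))) * ext_pairing Rp X"
proof -
  interpret M: markov_chain p P M by fact
  define c where "c = ext_pairing Rp X"
  obtain Y where Y: "X = (\<chi> w. mat c) + Y - ext_dual Y"
    using poisson_equation unfolding c_def by blast
  define t where "t n w = hs_pairing (rho_traj L \<rho> w n) (Y $ w (Suc n))" for n w
  define s where "s n w = hs_pairing (rho_traj L \<rho> w n) (ext_dual Y $ w (Suc n))" for n w
  \<comment> \<open>\<open>s n\<close> is the conditional expectation of \<open>t (Suc n)\<close>
    given the coordinates up to \<open>Suc n\<close>, so \<open>D n\<close> is the martingale
    difference at time n + 2.\<close>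
  define D where "D n w = t (Suc n) w - s n w" for n w
  obtain B where B: "\<forall>w n u. norm (hs_pairing (rho_traj L \<rho> w n) (Y $ u)) \<le> B"
    using norm_pairing_bounded[OF \<rho>, where X = "Y"] by (rule exE)
  obtain C where C: "\<forall>w n u. norm (hs_pairing (rho_traj L \<rho> w n) (ext_dual Y $ u)) \<le> C"
    using norm_pairing_bounded[OF \<rho>, where X = "ext_dual Y"] by (rule exE)
  have D: "determined_upto (Suc (Suc n)) (D n)" for n
    using determined_upto_pairing[of "Suc n" \<rho> Y]
      determined_upto_mono[OF determined_upto_pairing[of n \<rho> "ext_dual Y"], of "Suc (Suc n)"]
    unfolding D_def t_def s_def determined_upto_def by (metis le_Suc_eq)
  have mean: "(\<Sum>u\<in>UNIV. P $ w (Suc n) $ u *\<^sub>R D n (w(Suc (Suc n) := u))) = 0" for w n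
  proof -
    have "(\<Sum>u\<in>UNIV. P $ w (Suc n) $ u *\<^sub>R D n (w(Suc (Suc n) := u)))
      = (\<Sum>u\<in>UNIV. P $ w (Suc n) $ u *\<^sub>R hs_pairing (rho_traj L \<rho> w (Suc n)) (Y $ u)) - s n w"
      by (simp add: D_def t_def s_def rho_traj_fun_upd scaleR_diff_right sum_subtractf P_sum
          flip: scaleR_sum_left)
    then show ?thesis
      by (simp add: s_def hs_pairing_ext_dual scaleR_conv_of_real[where 'a=complex])
  qed
  have "AE w in M. ergodic_mean (\<lambda>n. D n w) \<longlonglongrightarrow> 0"
  proof (rule M.bounded_orthogonal_slln)
    show "D n \<in> borel_measurable M" for n
      using M.integrable_determined[OF D] by (rule borel_measurable_integrable)
    show "norm (D n w) \<le> B + C" for n w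
      unfolding D_def t_def s_def by (rule order_trans[OF norm_triangle_ineq4 add_mono[OF B[rule_format] C[rule_format]]])
    \<comment> \<open>For m < n, \<open>D m\<close> only sees coordinates up to m + 2 <= n + 1,
      given which \<open>D n\<close> has mean zero.\<close>
    show "M.expectation (\<lambda>w. inner (D m w) (D n w)) = 0" if "m < n" for m n
      using that by (intro M.fun_upd_mean_orthogonal[OF determined_upto_mono[OF D] D mean]) simp
  qed
  then show ?thesis
  proof eventually_elim
    case (elim w)
    \<comment> \<open>Pairing with the constant \<open>mat c\<close> produces the conjugate trace of
      the state, which stays at its initial value.\<close>
    define k where "k = cnj (trace (\<rho> (w 0))) * c"
    \<comment> \<open>The Poisson equation contributes \<open>t n w - s n w\<close>, and
      \<open>s n w\<close> is \<open>t (Suc n) w - D n w\<close>.\<close>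
    have step: "hs_pairing (rho_traj L \<rho> w n) (X $ w (Suc n)) = k + t n w - t (Suc n) w + D n w" for n
      by (subst Y) (simp add: hs_pairing_add_right hs_pairing_diff_right hs_pairing_mat
          trace_rho_traj k_def t_def s_def D_def)
    have sum: "(\<Sum>n<N. hs_pairing (rho_traj L \<rho> w n) (X $ w (Suc n)))
        = real N *\<^sub>R k + (t 0 w - t N w) + (\<Sum>n<N. D n w)" for N
      by (induction N) (simp_all add: step scaleR_add_left)
    have eq: "ergodic_mean (\<lambda>n. hs_pairing (rho_traj L \<rho> w n) (X $ w (Suc n))) N
        = k + (1 / real N) *\<^sub>R (t 0 w - t N w) + ergodic_mean (\<lambda>n. D n w) N" if "0 < N" for N
      using that unfolding ergodic_mean_def sum by (simp add: scaleR_add_right)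
    have "(\<lambda>N. (1 / real N) *\<^sub>R (t 0 w - t N w)) \<longlonglongrightarrow> 0"
    proof (rule Lim_null_comparison)
      have "norm (t 0 w - t N w) \<le> B + B" for N
        unfolding t_def by (rule order_trans[OF norm_triangle_ineq4 add_mono[OF B[rule_format] B[rule_format]]])
      then show "eventually (\<lambda>N. norm ((1 / real N) *\<^sub>R (t 0 w - t N w)) \<le> 1 / real N * (B + B)) sequentially"
        by (intro always_eventually allI) (simp add: divide_right_mono)
      show "(\<lambda>N. 1 / real N * (B + B)) \<longlonglongrightarrow> 0"
        using tendsto_mult_left_zero[OF lim_1_over_n] .
    qed
    then have "(\<lambda>N. k + (1 / real N) *\<^sub>R (t 0 w - t N w) + ergodic_mean (\<lambda>n. D n w) N) \<longlonglongrightarrow> k + 0 + 0"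
      by (intro tendsto_add tendsto_const elim)
    moreover have "eventually (\<lambda>N. k + (1 / real N) *\<^sub>R (t 0 w - t N w) + ergodic_mean (\<lambda>n. D n w) N
        = ergodic_mean (\<lambda>n. hs_pairing (rho_traj L \<rho> w n) (X $ w (Suc n))) N) sequentially"
      using eventually_gt_at_top[of "0 :: nat"] by (rule eventually_mono) (simp add: eq)
    ultimately show ?case
      unfolding k_def c_def by (simp add: Lim_transform_eventually)
  qed
qed

text \<open>The trajectory starts at \<open>proj v\<close>, whose trace |v|^2 is the factor
  appearing in the form of a multiple of the identity.\<close>

lemma qform_heisenberg_ergodic:
  assumes M: "markov_chain p P M"
  shows "AE w in M. (\<lambda>N. qform v (ergodic_mean (\<lambda>n. heisenberg L w n (X $ w (Suc n))) N))
    \<longlonglongrightarrow> qform v (mat (ext_pairing Rp X))"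
proof -
  have "qform v (ergodic_mean (\<lambda>n. heisenberg L w n (X $ w (Suc n))) N)
    = ergodic_mean (\<lambda>n. hs_pairing (rho_traj L (\<lambda>_. proj v) w n) (X $ w (Suc n))) N" for w N
    by (simp add: hs_pairing_heisenberg[OF clinear_L, symmetric] hs_pairing_proj
        ergodic_mean_linear[OF linear_qform])
  then show ?thesis
    using pairing_ergodic[OF M psd_proj, of "\<lambda>_. v" X]
    by (simp add: qform_mat trace_proj mult.commute)
qed

end

text \<open>The vectors occurring in \<open>qform_polarization\<close>. The set is finite, so almost
  sure convergence of the forms holds on all of it simultaneously.\<close>

definition polar_vectors :: "(complex ^ 'n) set" where
  "polar_vectors = (\<Union>i. \<Union>j. {axis i 1, axis i 1 + axis j 1, axis i 1 + axis j \<i>})"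

lemma finite_polar_vectors: "finite polar_vectors"
  by (simp add: polar_vectors_def)

lemma polar_vectors_mem:
  "axis i 1 \<in> polar_vectors" "axis i 1 + axis j 1 \<in> polar_vectors" "axis i 1 + axis j \<i> \<in> polar_vectors"
  by (auto simp: polar_vectors_def)

lemma tendsto_polar:
  assumes q: "\<And>v. v \<in> polar_vectors \<Longrightarrow> ((\<lambda>x. qform v (f x)) \<longlongrightarrow> qform v A) F"
  shows "(f \<longlongrightarrow> A) F"
proof -
  have "((\<lambda>x. f x $ i $ j) \<longlongrightarrow> A $ i $ j) F" for i j
    unfolding qform_polarization[of _ i j] by (intro tendsto_intros q polar_vectors_mem) auto
  then show ?thesis
    by (intro vec_tendstoI)
qed

text \<open>Polarization with |1 - \<i>| <= 2. It supplies the uniform entry bounds for dominated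
  convergence.\<close>

lemma norm_entry_polar_le:
  assumes q: "\<And>v. norm (qform v A) \<le> B v"
  shows "norm (A $ i $ j) \<le> B (axis i 1 + axis j 1) + B (axis i 1 + axis j \<i>) + B (axis i 1) + B (axis j 1)"
proof -
  let ?x = "qform (axis i 1 + axis j 1) A" and ?y = "qform (axis i 1 + axis j \<i>) A"
  have B: "0 \<le> B v" for v
    using order_trans[OF norm_ge_zero q] .
  have half: "2 * (z / 2) = z" for z :: complex
    by simp
  have "norm (2 * A $ i $ j) = norm (?x - \<i> * ?y - (1 - \<i>) * (qform (axis i 1) A + qform (axis j 1) A))"
    by (simp only: qform_polarization[of A i j] half)
  also have "\<dots> \<le> norm ?x + norm (\<i> * ?y) + norm ((1 - \<i>) * (qform (axis i 1) A + qform (axis j 1) A))"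
    by (intro norm_triangle_le_diff add_right_mono norm_triangle_ineq4)
  also have "norm (\<i> * ?y) = norm ?y"
    by (simp add: norm_mult)
  also have "norm ((1 - \<i>) * (qform (axis i 1) A + qform (axis j 1) A))
      \<le> 2 * (norm (qform (axis i 1) A) + norm (qform (axis j 1) A))"
    unfolding norm_mult using norm_triangle_ineq4[of 1 "\<i>"] by (intro mult_mono norm_triangle_ineq) auto
  finally show ?thesis
    using q[of "axis i 1 + axis j 1"] q[of "axis i 1 + axis j \<i>"] q[of "axis i 1"] q[of "axis j 1"]
      B[of "axis i 1 + axis j 1"] B[of "axis i 1 + axis j \<i>"]
    by (simp add: norm_mult)
qed

section \<open>Convergence of operators, of state pairings and of expectations\<close>

context irreducible_channels
begin

lemma heisenberg_ergodic:
  assumes M: "markov_chain p P M"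
  shows "AE w in M. ergodic_mean (\<lambda>n. heisenberg L w n (X $ w (Suc n))) \<longlonglongrightarrow> mat (ext_pairing Rp X)"
proof -
  have "AE w in M. \<forall>v\<in>polar_vectors. (\<lambda>N. qform v (ergodic_mean (\<lambda>n. heisenberg L w n (X $ w (Suc n))) N))
      \<longlonglongrightarrow> qform v (mat (ext_pairing Rp X))"
    using finite_polar_vectors by (rule AE_finite_allI) (rule qform_heisenberg_ergodic[OF M])
  then show ?thesis
    by eventually_elim (auto intro: tendsto_polar)
qed

text \<open>Each entry is a bounded complex sequence, to which dominated convergence applies; the
  operator norm is at most the sum of the entry norms.\<close>

lemma heisenberg_ergodic_L1:
  assumes M: "markov_chain p P M"
  shows "L1_tendsto op_norm M (\<lambda>N w. ergodic_mean (\<lambda>n. heisenberg L w n (X $ w (Suc n))) N)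
    (\<lambda>w. mat (ext_pairing Rp X))"
proof -
  interpret M: markov_chain p P M by fact
  define A where "A N w = ergodic_mean (\<lambda>n. heisenberg L w n (X $ w (Suc n))) N" for N w
  define c where "c = ext_pairing Rp X"
  have int: "integrable M (A N)" for N
    unfolding A_def
    by (rule M.integrable_determined[OF determined_upto_ergodic_mean[OF determined_upto_heisenberg]])
  have "\<exists>B. \<forall>N w. norm (qform v (A N w)) \<le> B" for v
  proof -
    have "\<exists>B. \<forall>w n u. norm (hs_pairing (rho_traj L (\<lambda>_. proj v) w n) (X $ u)) \<le> B"
      by (rule norm_pairing_bounded) (rule psd_proj)
    then obtain B where B: "\<forall>w n u. norm (hs_pairing (rho_traj L (\<lambda>_. proj v) w n) (X $ u)) \<le> B"
      by (rule exE)
    have "norm (qform v (A N w)) \<le> B" for N w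
      unfolding A_def ergodic_mean_linear[OF linear_qform, symmetric]
      by (intro norm_ergodic_mean_le) (simp add: B hs_pairing_heisenberg[OF clinear_L] flip: hs_pairing_proj)
    then show ?thesis by blast
  qed
  then obtain B where B: "\<And>v N w. norm (qform v (A N w)) \<le> B v"
    by metis
  have ent: "(\<lambda>N. LINT w|M. norm (A N w $ i $ j - mat c $ i $ j)) \<longlonglongrightarrow> 0" for i j
  proof (rule M.L1_convergence_of_bounded[OF _ norm_entry_polar_le[OF B]])
    show "(\<lambda>w. A N w $ i $ j) \<in> borel_measurable M" for N
      using int[of N, THEN borel_measurable_integrable] by (intro borel_measurable_continuous_on[of "\<lambda>A. A $ i $ j"] continuous_intros)
    show "AE w in M. (\<lambda>N. A N w $ i $ j) \<longlonglongrightarrow> mat c $ i $ j"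
      using heisenberg_ergodic[OF M, where X = X]
    proof eventually_elim
      case (elim w)
      then show ?case
        unfolding A_def c_def by (intro tendsto_vec_nth)
    qed
  qed
  have int_ent: "integrable M (\<lambda>w. norm (A N w $ i $ j - mat c $ i $ j))" for N i j
  proof -
    have "integrable M (\<lambda>w. A N w $ i $ j)"
      using integrable_bounded_linear[OF bounded_linear_compose[OF bounded_linear_vec_nth[of j] bounded_linear_vec_nth[of i]] int]
      by simp
    then show ?thesis by simp
  qed
  have "(\<lambda>N. LINT w|M. op_norm (A N w - mat c)) \<longlonglongrightarrow> 0"
  proof (rule tendsto_sandwich[OF _ _ tendsto_const])
    show "eventually (\<lambda>N. 0 \<le> (LINT w|M. op_norm (A N w - mat c))) sequentially"
      by (intro always_eventually allI integral_nonneg_AE AE_I2 op_norm_nonneg)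
    \<comment> \<open>\<open>integral_mono'\<close> takes its integrability from the majorant, here
      the finite sum of entry norms.\<close>
    have "(LINT w|M. op_norm (A N w - mat c))
        \<le> (LINT w|M. (\<Sum>i\<in>UNIV. \<Sum>j\<in>UNIV. norm (A N w $ i $ j - mat c $ i $ j)))" for N
      using op_norm_le[of "A N w - mat c" for w] op_norm_nonneg
      by (intro integral_mono') (auto intro!: Bochner_Integration.integrable_sum int_ent sum_nonneg)
    also have "(LINT w|M. (\<Sum>i\<in>UNIV. \<Sum>j\<in>UNIV. norm (A N w $ i $ j - mat c $ i $ j)))
        = (\<Sum>i\<in>UNIV. \<Sum>j\<in>UNIV. LINT w|M. norm (A N w $ i $ j - mat c $ i $ j))" for N
      by (simp add: Bochner_Integration.integral_sum Bochner_Integration.integrable_sum int_ent)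
    finally show "eventually (\<lambda>N. (LINT w|M. op_norm (A N w - mat c))
        \<le> (\<Sum>i\<in>UNIV. \<Sum>j\<in>UNIV. LINT w|M. norm (A N w $ i $ j - mat c $ i $ j))) sequentially"
      by (intro always_eventually allI)
    show "(\<lambda>N. \<Sum>i\<in>UNIV. \<Sum>j\<in>UNIV. LINT w|M. norm (A N w $ i $ j - mat c $ i $ j)) \<longlonglongrightarrow> 0"
      by (intro tendsto_null_sum ent)
  qed
  then show ?thesis
    using int by (simp add: L1_tendsto_def flip: A_def c_def)
qed

lemma state_pairing_ergodic:
  assumes M: "markov_chain p P M" and \<rho>: "\<And>w. is_state (\<rho> w)"
  shows "AE w in M. ergodic_mean (\<lambda>n. hs_pairing (rho_traj L \<rho> w n) (X $ w (Suc n)))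
      \<longlonglongrightarrow> ext_pairing Rp X"
    and "L1_tendsto norm M (\<lambda>N w. ergodic_mean (\<lambda>n. hs_pairing (rho_traj L \<rho> w n) (X $ w (Suc n))) N)
      (\<lambda>w. ext_pairing Rp X)"
proof -
  interpret M: markov_chain p P M by fact
  have psd: "psd (\<rho> w)" and tr: "trace (\<rho> w) = 1" for w
    using \<rho> by (auto simp: is_state_def)
  show AE: "AE w in M. ergodic_mean (\<lambda>n. hs_pairing (rho_traj L \<rho> w n) (X $ w (Suc n)))
      \<longlonglongrightarrow> ext_pairing Rp X"
    using pairing_ergodic[OF M psd, where X = X] by (simp add: tr)
  define f where "f N w = ergodic_mean (\<lambda>n. hs_pairing (rho_traj L \<rho> w n) (X $ w (Suc n))) N" for N w
  have int: "integrable M (f N)" for N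
    unfolding f_def
    by (rule M.integrable_determined[OF determined_upto_ergodic_mean[OF determined_upto_pairing]])
  obtain B where B: "\<forall>w n u. norm (hs_pairing (rho_traj L \<rho> w n) (X $ u)) \<le> B"
    using norm_pairing_bounded[OF psd, where X = X] by (rule exE)
  have "(\<lambda>N. LINT w|M. norm (f N w - ext_pairing Rp X)) \<longlonglongrightarrow> 0"
  proof (rule M.L1_convergence_of_bounded)
    show "f N \<in> borel_measurable M" for N
      using int by (rule borel_measurable_integrable)
    show "norm (f N w) \<le> B" for N w
      unfolding f_def by (intro norm_ergodic_mean_le B[rule_format])
    show "AE w in M. (\<lambda>N. f N w) \<longlonglongrightarrow> ext_pairing Rp X"
      unfolding f_def by (rule AE)
  qed
  then show "L1_tendsto norm M (\<lambda>N w. ergodic_mean (\<lambda>n. hs_pairing (rho_traj L \<rho> w n) (X $ w (Suc n))) N)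
      (\<lambda>w. ext_pairing Rp X)"
    using int by (simp add: L1_tendsto_def flip: f_def)
qed

text \<open>By \<open>expectation_pairing\<close> the expectation pairs \<open>X\<close> with
  iterates of the extended map on \<open>?R\<close>, which is an extended state since the weights
  p_u P_uv sum to one.\<close>

lemma expectation_pairing_tendsto:
  assumes prim: "primitive_map (ext_map P L)" and M: "markov_chain p P M"
    and \<rho>: "\<And>w. is_state (\<rho> w)"
  shows "(\<lambda>n. LINT w|M. hs_pairing (rho_traj L \<rho> w n) (X $ w (Suc n))) \<longlonglongrightarrow> ext_pairing Rp X"
proof -
  interpret M: markov_chain p P M by fact
  let ?R = "\<chi> v. \<Sum>u\<in>UNIV. (p $ u * P $ u $ v) *\<^sub>R \<rho> u"
  have psd: "psd (\<rho> w)" and tr: "trace (\<rho> w) = 1" for w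
    using \<rho> by (auto simp: is_state_def)
  have "ext_nonneg ?R"
    using psd by (auto simp: ext_nonneg_iff qform_sum qform_scaleR psd_iff M.p_nonneg M.P_nonneg intro!: sum_nonneg)
  moreover have "ext_trace ?R = (\<Sum>u\<in>UNIV. \<Sum>v\<in>UNIV. of_real (p $ u * P $ u $ v))"
    unfolding ext_trace_def by (subst sum.swap) (simp add: trace_sum trace_scaleR tr)
  then have "ext_trace ?R = 1"
    by (simp add: M.p_sum M.P_sum flip: sum_distrib_left of_real_sum of_real_mult)
  ultimately have "(\<lambda>n. (ext_map P L ^^ n) ?R) \<longlonglongrightarrow> Rp"
    by (intro primitive_tendsto[OF prim]) (simp add: extended_state_iff)
  then have "(\<lambda>n. ext_pairing ((ext_map P L ^^ n) ?R) X) \<longlonglongrightarrow> ext_pairing Rp X"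
    by (rule bounded_linear.tendsto[OF linear_conv_bounded_linear[THEN iffD1, OF linear_ext_pairing_left]])
  then show ?thesis
    by (simp only: expectation_pairing[OF M])
qed

end

theorem theorem3p3:
  fixes \<pi> :: "real ^ 'w"
    and P :: "real ^ 'w ^ 'w"
    and L :: "'w \<Rightarrow> complex ^ 'n ^ 'n \<Rightarrow> complex ^ 'n ^ 'n"
  assumes "prob_vector \<pi>"
    and "right_stochastic P"
    and "\<And>w. cptp (L w)"
    and "irreducible_map (ext_map P L)"
  shows "\<exists>Rp \<pi>p.
    extended_steady_state P L Rp \<and> (\<forall>R. extended_steady_state P L R \<longrightarrow> R = Rp) \<and>
    invariant_prob_vector P \<pi>p \<and> (\<forall>p. invariant_prob_vector P p \<longrightarrow> p = \<pi>p) \<and>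
    (\<forall>w. of_real (\<pi>p $ w) = trace (Rp $ w)) \<and>
    faithful Rp \<and>
    (\<forall>X :: complex ^ 'n ^ 'n ^ 'w.
      (AE w in markov_measure \<pi> P.
        ergodic_mean (\<lambda>n. heisenberg L w n (X $ w (Suc n))) \<longlonglongrightarrow> mat (ext_pairing Rp X)) \<and>
      L1_tendsto op_norm (markov_measure \<pi> P)
        (\<lambda>N w. ergodic_mean (\<lambda>n. heisenberg L w n (X $ w (Suc n))) N)
        (\<lambda>w. mat (ext_pairing Rp X))) \<and>
    (\<forall>\<rho> :: 'w \<Rightarrow> complex ^ 'n ^ 'n. (\<forall>w. is_state (\<rho> w)) \<longrightarrow>
      (\<forall>X :: complex ^ 'n ^ 'n ^ 'w.
        (AE w in markov_measure \<pi> P.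
          ergodic_mean (\<lambda>n. hs_pairing (rho_traj L \<rho> w n) (X $ w (Suc n)))
            \<longlonglongrightarrow> ext_pairing Rp X) \<and>
        L1_tendsto norm (markov_measure \<pi> P)
          (\<lambda>N w. ergodic_mean (\<lambda>n. hs_pairing (rho_traj L \<rho> w n) (X $ w (Suc n))) N)
          (\<lambda>w. ext_pairing Rp X) \<and>
        (primitive_map (ext_map P L) \<longrightarrow>
          (\<lambda>n. LINT w|markov_measure \<pi>p P.
            hs_pairing (rho_traj L \<rho> w n) (X $ w (Suc n))) \<longlonglongrightarrow> ext_pairing Rp X)))"
proof -
  interpret environment_channels P L
    by standard (fact assms)+
  \<comment> \<open>Existence is settled first, in the weaker locale, since \<open>Rp\<close> is a
    parameter of the second interpretation.\<close>
  obtain Rp where steady_Rp: "extended_steady_state P L Rp"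
    using steady_state_exists by blast
  interpret irreducible_channels P L Rp
    by standard (fact assms steady_Rp)+
  define q where "q = (\<chi> w. Re (trace (Rp $ w)))"
  have q: "invariant_prob_vector P q"
    unfolding q_def using steady_state_traces_invariant[OF steady_Rp] .
  \<comment> \<open>Every invariant vector consists of the traces of some steady state, and
    \<open>Rp\<close> is the only one.\<close>
  have unique: "p = q" if p: "invariant_prob_vector P p" for p
  proof -
    obtain R where R: "extended_steady_state P L R" "\<And>w. trace (R $ w) = of_real (p $ w)"
      using steady_state_of_invariant[OF p] by metis
    then show ?thesis
      using steady_state_unique[OF R(1)] by (simp add: q_def vec_eq_iff)
  qed
  have trace: "of_real (q $ w) = trace (Rp $ w)" for w
    using psd_diag[of "Rp $ w"] Rp(1) by (simp add: q_def complex_eq_iff trace_def ext_nonneg_def)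
  have M: "markov_chain \<pi> P (markov_measure \<pi> P)" "markov_chain q P (markov_measure q P)"
    using assms q by (auto simp: markov_chain_def invariant_prob_vector_def intro: markov_measure)
  show ?thesis
    by (rule exI[of _ Rp], rule exI[of _ q], intro conjI allI impI)
      (use steady_Rp steady_state_unique q unique trace faithful_Rp heisenberg_ergodic[OF M(1)]
        heisenberg_ergodic_L1[OF M(1)] state_pairing_ergodic[OF M(1)]
        expectation_pairing_tendsto[OF _ M(2)] in blast)+
qed

end
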